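(* Let $X$ be a finite alphabet with at least two letters and $k\ge2$. On $\mathcal{R}_k$ the relation $\leq_{CA}$ coincides with $\leq_{DA}$, and on $\mathcal{A}_k$ the relation $\leq_{CA}$ coincides with $\leq_{AA}$.
   Context: $X^\omega$ carries the Cantor topology; $\bar k=\{0,\dots,k-1\}$; a $k$-partition of $X^\omega$ is a function $X^\omega\to\bar k$. An automaton is $\mathcal{M}=(Q,f,in)$ with finite $Q$, $f:Q\times X\to Q$, initial state $in$; $f_{\mathcal M}(\xi)$ is the set of states visited infinitely often on input $\xi\in X^\omega$. Regular $\omega$-languages are those of the form $\{\xi:f_{\mathcal M}(\xi)\in\mathcal F\}$ for some automaton $\mathcal M$ and set $\mathcal F$ of state sets. $\mathcal M$ is aperiodic if $f(q,u^n)=q$ with $u$ nonempty and $n>0$ implies $f(q,u)=q$; aperiodic $\omega$-languages are those recognised this way with $\mathcal M$ aperiodic. $\mathcal R_k$ ($\mathcal A_k$) is the set of $k$-partitions all of whose components are regular (aperiodic). An asynchronous transducer is an automaton $\mathcal M$ together with an output function $g:Q\times X\to X^*$; on input $\xi$ it outputs the concatenation of $g(f(in,\xi\upharpoonright_n),\xi(n))$, $n<\omega$. A DA-function is a function $X^\omega\to X^\omega$ computed by an asynchronous transducer; an AA-function is one computed by an asynchronous transducer whose automaton is aperiodic. For $k$-partitions $A,B$: $A\le_{CA}B$ iff $A=B\circ h$ for some continuous $h:X^\omega\to X^\omega$; $A\le_{DA}B$ (resp. $A\le_{AA}B$) iff $A=B\circ h$ for some DA-function (resp. AA-function) $h$.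 *)

theory Defs
  imports Main
begin

type_synonym 'a oword = "nat \<Rightarrow> 'a"

definition kpartition :: "nat \<Rightarrow> ('a oword \<Rightarrow> nat) \<Rightarrow> bool" where
  "kpartition k A \<longleftrightarrow> (\<forall>\<xi>. A \<xi> < k)"

definition cantor_continuous :: "('a oword \<Rightarrow> 'b oword) \<Rightarrow> bool" where
  "cantor_continuous h \<longleftrightarrow>
     (\<forall>\<xi> n. \<exists>m. \<forall>\<eta>. (\<forall>i<m. \<eta> i = \<xi> i) \<longrightarrow> (\<forall>i<n. h \<eta> i = h \<xi> i))"

definition automaton :: "nat set \<Rightarrow> (nat \<Rightarrow> 'a \<Rightarrow> nat) \<Rightarrow> nat \<Rightarrow> bool" where
  "automaton Q f q0 \<longleftrightarrow> finite Q \<and> q0 \<in> Q \<and> (\<forall>q\<in>Q. \<forall>x. f q x \<in> Q)"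

definition ftrans :: "(nat \<Rightarrow> 'a \<Rightarrow> nat) \<Rightarrow> nat \<Rightarrow> 'a list \<Rightarrow> nat" where
  "ftrans f q u = foldl f q u"

definition run :: "(nat \<Rightarrow> 'a \<Rightarrow> nat) \<Rightarrow> nat \<Rightarrow> 'a oword \<Rightarrow> nat \<Rightarrow> nat" where
  "run f q0 \<xi> n = ftrans f q0 (map \<xi> [0..<n])"

definition inf_states :: "(nat \<Rightarrow> 'a \<Rightarrow> nat) \<Rightarrow> nat \<Rightarrow> 'a oword \<Rightarrow> nat set" where
  "inf_states f q0 \<xi> = {q. infinite {n. run f q0 \<xi> n = q}}"

definition aperiodic_aut :: "nat set \<Rightarrow> (nat \<Rightarrow> 'a \<Rightarrow> nat) \<Rightarrow> bool" where
  "aperiodic_aut Q f \<longleftrightarrow>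
     (\<forall>q\<in>Q. \<forall>u n. u \<noteq> [] \<and> n > 0 \<and> ftrans f q (concat (replicate n u)) = q
        \<longrightarrow> ftrans f q u = q)"

definition regular_lang :: "'a oword set \<Rightarrow> bool" where
  "regular_lang L \<longleftrightarrow> (\<exists>Q f q0 \<F>. automaton Q f q0 \<and>
      L = {\<xi>. inf_states f q0 \<xi> \<in> \<F>})"

definition aperiodic_lang :: "'a oword set \<Rightarrow> bool" where
  "aperiodic_lang L \<longleftrightarrow> (\<exists>Q f q0 \<F>. automaton Q f q0 \<and> aperiodic_aut Q f \<and>
      L = {\<xi>. inf_states f q0 \<xi> \<in> \<F>})"

definition RR :: "nat \<Rightarrow> ('a oword \<Rightarrow> nat) set" where
  "RR k = {A. kpartition k A \<and> (\<forall>i<k. regular_lang {\<xi>. A \<xi> = i})}"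

definition AA :: "nat \<Rightarrow> ('a oword \<Rightarrow> nat) set" where
  "AA k = {A. kpartition k A \<and> (\<forall>i<k. aperiodic_lang {\<xi>. A \<xi> = i})}"

definition out_prefix ::
  "(nat \<Rightarrow> 'a \<Rightarrow> nat) \<Rightarrow> (nat \<Rightarrow> 'a \<Rightarrow> 'a list) \<Rightarrow> nat \<Rightarrow> 'a oword \<Rightarrow> nat \<Rightarrow> 'a list" where
  "out_prefix f g q0 \<xi> n = concat (map (\<lambda>j. g (run f q0 \<xi> j) (\<xi> j)) [0..<n])"

definition computes ::
  "(nat \<Rightarrow> 'a \<Rightarrow> nat) \<Rightarrow> (nat \<Rightarrow> 'a \<Rightarrow> 'a list) \<Rightarrow> nat \<Rightarrow> ('a oword \<Rightarrow> 'a oword) \<Rightarrow> bool" where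
  "computes f g q0 h \<longleftrightarrow> (\<forall>\<xi>.
      (\<forall>m. \<exists>n. m < length (out_prefix f g q0 \<xi> n)) \<and>
      (\<forall>n i. i < length (out_prefix f g q0 \<xi> n) \<longrightarrow> h \<xi> i = out_prefix f g q0 \<xi> n ! i))"

definition DA_function :: "('a oword \<Rightarrow> 'a oword) \<Rightarrow> bool" where
  "DA_function h \<longleftrightarrow> (\<exists>Q f q0 g. automaton Q f q0 \<and> computes f g q0 h)"

definition AA_function :: "('a oword \<Rightarrow> 'a oword) \<Rightarrow> bool" where
  "AA_function h \<longleftrightarrow> (\<exists>Q f q0 g. automaton Q f q0 \<and> aperiodic_aut Q f \<and> computes f g q0 h)"

definition le_CA :: "('a oword \<Rightarrow> nat) \<Rightarrow> ('a oword \<Rightarrow> nat) \<Rightarrow> bool" where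
  "le_CA A B \<longleftrightarrow> (\<exists>h. cantor_continuous h \<and> A = B \<circ> h)"

definition le_DA :: "('a oword \<Rightarrow> nat) \<Rightarrow> ('a oword \<Rightarrow> nat) \<Rightarrow> bool" where
  "le_DA A B \<longleftrightarrow> (\<exists>h. DA_function h \<and> A = B \<circ> h)"

definition le_AA :: "('a oword \<Rightarrow> nat) \<Rightarrow> ('a oword \<Rightarrow> nat) \<Rightarrow> bool" where
  "le_AA A B \<longleftrightarrow> (\<exists>h. AA_function h \<and> A = B \<circ> h)"

end

theory Submission
  imports Defs "HOL-Library.Omega_Words_Fun"
begin

text \<open>Only one direction needs work: a continuous reduction has to be replaced by one computed by a
  transducer. Let automata (products of those for the components) read the input and the output, and
  colour their limit sets. If a continuous function reduces the inputs staying inside a set of states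
  \<open>L\<close> to outputs staying inside \<open>S\<close>, then for every strongly connected \<open>L' \<subseteq> L\<close> there is a strongly
  connected \<open>S' \<subseteq> S\<close> of the same colour such that inputs staying inside \<open>L'\<close> can be reduced to
  outputs staying inside \<open>S'\<close>: choose a residual of the reduction whose set of possible output states
  is minimal. The transducer maintains a stack of such nested pairs. Whenever the input automaton
  returns to a state, the set \<open>H\<close> of states seen since the previous visit is a loop; levels not
  containing \<open>H\<close> are popped, a level for \<open>H\<close> is pushed, and the output tours its second component. If
  \<open>L\<close> is the limit set of the input, then eventually \<open>H \<subseteq> L\<close> and infinitely often \<open>H = L\<close>; hence a
  level \<open>(L, S)\<close> persists, and the output has limit set \<open>S\<close>. If the word \<open>u\<close> fixes the state of the
  input automaton and some power of \<open>u\<close> fixes the memory, then so does \<open>u\<close>: the memory is the same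
  each time \<open>H\<close> is the set of all states on the loop \<open>u\<close>. So the transducer is aperiodic whenever the
  input automaton is.\<close>

section \<open>Runs, strong connectivity and continuity\<close>

fun visited :: "('s \<Rightarrow> 'a \<Rightarrow> 's) \<Rightarrow> 's \<Rightarrow> 'a list \<Rightarrow> 's set" where
  "visited f s [] = {s}"
| "visited f s (x # w) = insert s (visited f (f s x) w)"

lemma visited_append: "visited f s (u @ v) = visited f s u \<union> visited f (foldl f s u) v"
proof (induction u arbitrary: s)
  case Nil
  then show ?case by (cases v) auto
qed auto

lemma visited_start [simp]: "s \<in> visited f s w"
  by (cases w) auto

lemma visited_end [simp]: "foldl f s w \<in> visited f s w"
  by (induction w arbitrary: s) auto

lemma visited_split:
  assumes "t \<in> visited f s w"
  obtains u v where "w = u @ v" and "foldl f s u = t"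
  using assms
proof (induction w arbitrary: s thesis)
  case Nil
  then show ?case by auto
next
  case (Cons x w)
  show ?case
  proof (cases "t = s")
    case True
    then show ?thesis using Cons.prems(1)[of "[]" "x # w"] by simp
  next
    case False
    then have "t \<in> visited f (f s x) w" using Cons.prems(2) by simp
    then obtain u v where "w = u @ v" "foldl f (f s x) u = t"
      using Cons.IH by blast
    then show ?thesis using Cons.prems(1)[of "x # u" v] by simp
  qed
qed

text \<open>The counterpart of \<open>run\<close> for states of any type, built on
  \<open>prefix\<close> so that \<open>limit\<close> gives the set of states visited infinitely
  often.\<close>

definition trail :: "('s \<Rightarrow> 'a \<Rightarrow> 's) \<Rightarrow> 's \<Rightarrow> 'a oword \<Rightarrow> nat \<Rightarrow> 's" where
  "trail f s \<xi> n = foldl f s (prefix n \<xi>)"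

lemma trail_0 [simp]: "trail f s \<xi> 0 = s"
  by (simp add: trail_def)

lemma trail_Suc: "trail f s \<xi> (Suc n) = f (trail f s \<xi> n) (\<xi> n)"
  by (simp add: trail_def)

lemma foldl_subsequence_trail:
  "m \<le> n \<Longrightarrow> foldl f (trail f s \<xi> m) (\<xi> [m \<rightarrow> n]) = trail f s \<xi> n"
  using subsequence_append[where i = m and j = "n - m" and w = \<xi>] by (simp add: trail_def)

lemma visited_subsequence_trail:
  "m \<le> n \<Longrightarrow> visited f (trail f s \<xi> m) (\<xi> [m \<rightarrow> n]) = trail f s \<xi> ` {m..n}"
proof (induction n rule: dec_induct)
  case (step n)
  have "{m..Suc n} = insert (Suc n) {m..n}" using step by auto
  then show ?case
    using step by (auto simp: visited_append foldl_subsequence_trail trail_Suc)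
qed auto

lemma suffix_trail_conc:
  "suffix (length u) (trail f s (u \<frown> \<xi>)) = trail f (foldl f s u) \<xi>"
  by (rule ext) (simp add: trail_def)

lemma range_trail_conc:
  "range (trail f s (u \<frown> \<xi>)) = visited f s u \<union> range (trail f (foldl f s u) \<xi>)"
proof -
  let ?t = "trail f s (u \<frown> \<xi>)"
  have "range ?t = ?t ` {0..length u} \<union> range (suffix (length u) ?t)"
  proof (intro equalityI subsetI)
    fix x assume "x \<in> range ?t"
    then obtain n where n: "x = ?t n" by auto
    show "x \<in> ?t ` {0..length u} \<union> range (suffix (length u) ?t)"
    proof (cases "n \<le> length u")
      case False
      then have "x = suffix (length u) ?t (n - length u)" using n by simp
      then show ?thesis by blast
    qed (use n in auto)
  qed auto
  moreover have "?t ` {0..length u} = visited f s u"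
    using visited_subsequence_trail[of 0 "length u" f s "u \<frown> \<xi>"] by simp
  ultimately show ?thesis by (simp add: suffix_trail_conc)
qed

lemma limit_trail_conc:
  "limit (trail f s (u \<frown> \<xi>)) = limit (trail f (foldl f s u) \<xi>)"
  by (metis suffix_trail_conc limit_suffix)

lemma prefix_prefix:
  assumes "prefix n \<xi> = prefix n \<eta>" "m \<le> n"
  shows "prefix m \<xi> = prefix m \<eta>"
proof -
  have "take m (prefix n \<xi>) = take m (prefix n \<eta>)" using assms(1) by simp
  then show ?thesis using assms(2) by (simp add: min_absorb2)
qed

lemma trail_cong:
  assumes "prefix n \<xi> = prefix n \<eta>" "m \<le> n"
  shows "trail f s \<xi> m = trail f s \<eta> m"
  using prefix_prefix[OF assms] by (simp add: trail_def)

text \<open>The word \<open>w\<close> must be nonempty even for \<open>s = t\<close>; this excludes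
  a single state without a loop, where no infinite run could stay.\<close>

definition strongly_connected :: "('s \<Rightarrow> 'a \<Rightarrow> 's) \<Rightarrow> 's set \<Rightarrow> bool" where
  "strongly_connected f S \<longleftrightarrow> S \<noteq> {} \<and>
     (\<forall>s\<in>S. \<forall>t\<in>S. \<exists>w. w \<noteq> [] \<and> foldl f s w = t \<and> visited f s w \<subseteq> S)"

lemma strongly_connectedE:
  assumes "strongly_connected f S" "s \<in> S" "t \<in> S"
  obtains w where "w \<noteq> []" "foldl f s w = t" "visited f s w \<subseteq> S"
  using assms unfolding strongly_connected_def by blast

text \<open>From \<open>a\<close> finish the cycle, run it once more from \<open>s\<close> and stop
  at \<open>b\<close>. The extra round makes the connecting word nonempty.\<close>

lemma strongly_connected_cycle:
  assumes "w \<noteq> []" and cyc: "foldl f s w = s"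
  shows "strongly_connected f (visited f s w)"
  unfolding strongly_connected_def
proof (intro conjI ballI)
  show "visited f s w \<noteq> {}" using visited_start[of s f w] by blast
  fix a b assume "a \<in> visited f s w" "b \<in> visited f s w"
  then obtain u v u' v' where a: "w = u @ v" "foldl f s u = a" and b: "w = u' @ v'" "foldl f s u' = b"
    by (meson visited_split)
  have va: "foldl f a v = s" using a cyc by (metis foldl_append)
  have "visited f a v \<subseteq> visited f s w" using a by (auto simp: visited_append)
  moreover have "visited f s u' \<subseteq> visited f s w" using b by (auto simp: visited_append)
  ultimately have "visited f a (v @ w @ u') \<subseteq> visited f s w"
    using va cyc by (auto simp: visited_append)
  moreover have "foldl f a (v @ w @ u') = b" using va cyc b by simp
  ultimately show "\<exists>w'. w' \<noteq> [] \<and> foldl f a w' = b \<and> visited f a w' \<subseteq> visited f s w"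
    using assms(1) by blast
qed

text \<open>The states are collected one after another by induction over finite subsets; a last
  nonempty word then leads to \<open>t\<close>.\<close>

lemma strongly_connected_tour:
  assumes S: "strongly_connected f S" "finite S" and st: "s \<in> S" "t \<in> S"
  obtains w where "w \<noteq> []" "foldl f s w = t" "visited f s w = S"
proof -
  have "\<exists>w. foldl f s w \<in> S \<and> F \<subseteq> visited f s w \<and> visited f s w \<subseteq> S" if "finite F" "F \<subseteq> S" for F
    using that
  proof (induction F rule: finite_induct)
    case empty
    then show ?case using st by (intro exI[of _ "[]"]) auto
  next
    case (insert x F)
    then obtain w where w: "foldl f s w \<in> S" "F \<subseteq> visited f s w" "visited f s w \<subseteq> S" by auto
    obtain v where v: "foldl f (foldl f s w) v = x" "visited f (foldl f s w) v \<subseteq> S"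
      using strongly_connectedE[OF S(1) w(1), of x] insert.prems by auto
    have "x \<in> visited f (foldl f s w) v" using v(1) visited_end by metis
    then show ?case using w v insert.prems
      by (intro exI[of _ "w @ v"]) (auto simp: visited_append)
  qed
  then obtain w where w: "foldl f s w \<in> S" "S \<subseteq> visited f s w" "visited f s w \<subseteq> S"
    using S(2) by blast
  obtain v where v: "v \<noteq> []" "foldl f (foldl f s w) v = t" "visited f (foldl f s w) v \<subseteq> S"
    using strongly_connectedE[OF S(1) w(1) st(2)] .
  show ?thesis
  proof
    show "w @ v \<noteq> []" "foldl f s (w @ v) = t" using v by auto
    show "visited f s (w @ v) = S" using w v by (auto simp: visited_append)
  qed
qed

text \<open>The first letter of a nonempty word from a state back to itself keeps the run inside
  \<open>S\<close>; iterating this choice gives the input.\<close>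

lemma strongly_connected_infinite_path:
  assumes "strongly_connected f S" "s \<in> S"
  obtains \<xi> where "range (trail f s \<xi>) \<subseteq> S"
proof -
  have "\<exists>x. f t x \<in> S" if t: "t \<in> S" for t
  proof -
    obtain w where w: "w \<noteq> []" "foldl f t w = t" "visited f t w \<subseteq> S"
      using strongly_connectedE[OF assms(1) t t] .
    then obtain x v where "w = x # v" by (cases w) auto
    then have "visited f (f t x) v \<subseteq> S" using w(3) by simp
    then show ?thesis using visited_start[of "f t x" f v] by blast
  qed
  then obtain c where c: "\<And>t. t \<in> S \<Longrightarrow> f t (c t) \<in> S" by metis
  define r where "r n = ((\<lambda>t. f t (c t)) ^^ n) s" for n
  have "trail f s (\<lambda>n. c (r n)) n = r n" for n
    by (induction n) (auto simp: r_def trail_Suc)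
  moreover have "r n \<in> S" for n
    by (induction n) (auto simp: r_def assms c)
  ultimately show thesis by (intro that[of "\<lambda>n. c (r n)"]) auto
qed

section \<open>Continuity and residuals of continuous functions\<close>

lemma cantor_continuous_prefix:
  "cantor_continuous h \<longleftrightarrow>
     (\<forall>\<xi> n. \<exists>m. \<forall>\<eta>. prefix m \<eta> = prefix m \<xi> \<longrightarrow> prefix n (h \<eta>) = prefix n (h \<xi>))"
proof -
  have *: "prefix m \<eta> = prefix m \<xi> \<longleftrightarrow> (\<forall>i<m. \<eta> i = \<xi> i)" for m and \<eta> \<xi> :: "'x oword"
    by (auto simp: subsequence_def)
  show ?thesis unfolding cantor_continuous_def * ..
qed

text \<open>After finitely many input letters the first \<open>n\<close> output letters are settled.
  The bound \<open>k\<close> lets the caller ask that at least \<open>k\<close> letters have been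
  read.\<close>

lemma cantor_continuous_commit:
  assumes "cantor_continuous h"
  obtains m where "m \<ge> k" "\<And>\<zeta>. prefix n (h (prefix m \<xi> \<frown> \<zeta>)) = prefix n (h \<xi>)"
proof -
  obtain m where m: "\<And>\<eta>. prefix m \<eta> = prefix m \<xi> \<Longrightarrow> prefix n (h \<eta>) = prefix n (h \<xi>)"
    using assms unfolding cantor_continuous_prefix by metis
  show thesis
  proof
    show "max m k \<ge> k" by simp
    fix \<zeta>
    have "prefix (max m k) (prefix (max m k) \<xi> \<frown> \<zeta>) = prefix (max m k) \<xi>" by simp
    then show "prefix n (h (prefix (max m k) \<xi> \<frown> \<zeta>)) = prefix n (h \<xi>)"
      by (intro m) (rule prefix_prefix, auto)
  qed
qed

text \<open>The residual is what remains of \<open>h\<close> to compute once \<open>u\<close> has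
  been read and \<open>k\<close> letters have been written.\<close>

lemma cantor_continuous_residual:
  assumes "cantor_continuous h"
  shows "cantor_continuous (\<lambda>\<xi>. suffix k (h (u \<frown> \<xi>)))"
  unfolding cantor_continuous_def
proof (intro allI)
  fix \<xi> n
  obtain m where m: "\<And>\<eta>. (\<forall>i<m. \<eta> i = (u \<frown> \<xi>) i) \<Longrightarrow> (\<forall>i<k + n. h \<eta> i = h (u \<frown> \<xi>) i)"
    using assms unfolding cantor_continuous_def by meson
  have "\<forall>i<n. suffix k (h (u \<frown> \<eta>)) i = suffix k (h (u \<frown> \<xi>)) i" if "\<forall>i<m. \<eta> i = \<xi> i" for \<eta>
    using m[of "u \<frown> \<eta>"] that by (auto simp: conc_def)
  then show "\<exists>m. \<forall>\<eta>. (\<forall>i<m. \<eta> i = \<xi> i) \<longrightarrow> (\<forall>i<n. suffix k (h (u \<frown> \<eta>)) i = suffix k (h (u \<frown> \<xi>)) i)"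
    by blast
qed

lemma cantor_continuous_conc:
  assumes "cantor_continuous h"
  shows "cantor_continuous (\<lambda>\<xi>. u \<frown> h \<xi>)"
  using assms unfolding cantor_continuous_def conc_def by (metis less_imp_diff_less)

lemma prefix_eqD: "prefix n \<xi> = prefix n \<eta> \<Longrightarrow> i < n \<Longrightarrow> \<xi> i = \<eta> i"
  by (metis subsequence_nth diff_zero add_0)

section \<open>Restricting a reduction to a loop\<close>

locale aut_pair =
  fixes f :: "'p \<Rightarrow> 'a \<Rightarrow> 'p" and g :: "'q \<Rightarrow> 'b \<Rightarrow> 'q"
    and a :: "'p set \<Rightarrow> 'c" and b :: "'q set \<Rightarrow> 'c"
begin

text \<open>The colours are compared only for inputs that stay inside \<open>L\<close>, so the same
  function can serve for a smaller \<open>L'\<close>; elsewhere only continuity is demanded.\<close>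

definition reduction :: "'p set \<Rightarrow> 'q set \<Rightarrow> 'p \<Rightarrow> 'q \<Rightarrow> ('a oword \<Rightarrow> 'b oword) \<Rightarrow> bool" where
  "reduction L S p q h \<longleftrightarrow> cantor_continuous h \<and>
     (\<forall>\<xi>. range (trail f p \<xi>) \<subseteq> L \<longrightarrow>
        range (trail g q (h \<xi>)) \<subseteq> S \<and> a (limit (trail f p \<xi>)) = b (limit (trail g q (h \<xi>))))"

definition reduces :: "'p set \<Rightarrow> 'q set \<Rightarrow> 'p \<Rightarrow> 'q \<Rightarrow> bool" where
  "reduces L S p q \<longleftrightarrow> (\<exists>h. reduction L S p q h)"

text \<open>After reading \<open>u\<close> the function is committed to \<open>v\<close>. Both words
  can be split off because limit sets do not depend on finite prefixes.\<close>

lemma reduction_residual: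
  assumes h: "reduction L S p q h" and u: "visited f p u \<subseteq> L"
    and v: "\<And>\<xi>. prefix (length v) (h (u \<frown> \<xi>)) = v"
  shows "reduction L S (foldl f p u) (foldl g q v) (\<lambda>\<xi>. suffix (length v) (h (u \<frown> \<xi>)))"
proof -
  have eq: "h (u \<frown> \<xi>) = v \<frown> suffix (length v) (h (u \<frown> \<xi>))" for \<xi>
    by (metis v prefix_suffix)
  have "range (trail g (foldl g q v) (suffix (length v) (h (u \<frown> \<xi>)))) \<subseteq> S \<and>
      a (limit (trail f (foldl f p u) \<xi>)) =
      b (limit (trail g (foldl g q v) (suffix (length v) (h (u \<frown> \<xi>)))))"
    if "range (trail f (foldl f p u) \<xi>) \<subseteq> L" for \<xi>
  proof -
    have "range (trail f p (u \<frown> \<xi>)) \<subseteq> L"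
      using that u by (simp add: range_trail_conc)
    then have "range (trail g q (h (u \<frown> \<xi>))) \<subseteq> S"
      "a (limit (trail f p (u \<frown> \<xi>))) = b (limit (trail g q (h (u \<frown> \<xi>))))"
      using h unfolding reduction_def by blast+
    then show ?thesis
      using range_trail_conc[of g q v "suffix (length v) (h (u \<frown> \<xi>))"]
        limit_trail_conc[of g q v "suffix (length v) (h (u \<frown> \<xi>))"]
      by (simp add: eq[symmetric] limit_trail_conc)
  qed
  then show ?thesis
    using h cantor_continuous_residual unfolding reduction_def by blast
qed

text \<open>The residual with \<open>v = []\<close>: the word \<open>u\<close> is read while no
  output is written.\<close>

lemma reduces_delay:
  assumes "reduces L S p q" "visited f p u \<subseteq> L"
  shows "reduces L S (foldl f p u) q"
  using assms reduction_residual[of L S p q _ u "[]"] unfolding reduces_def by auto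

text \<open>Before following the given reduction the output walks from \<open>q'\<close> to
  \<open>q\<close> inside \<open>S\<close>, which does not affect its limit set.\<close>

lemma reduces_prepend:
  assumes "reduces L S p q" "foldl g q' v = q" "visited g q' v \<subseteq> S"
  shows "reduces L S p q'"
proof -
  obtain h where h: "reduction L S p q h" using assms(1) reduces_def by blast
  then have "reduction L S p q' (\<lambda>\<xi>. v \<frown> h \<xi>)"
    using assms(2,3) cantor_continuous_conc
    by (auto simp: reduction_def range_trail_conc limit_trail_conc)
  then show ?thesis using reduces_def by blast
qed

text \<open>A reduction whose set of possible output states cannot be shrunk by reading and writing
  more letters can be driven through all of these states forever.\<close>

lemma generic_word:
  assumes cont: "cantor_continuous h"
    and L: "strongly_connected f L" "finite L" "p \<in> L" and "finite S" "S \<noteq> {}"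
    and out: "\<And>\<xi>. range (trail f p \<xi>) \<subseteq> L \<Longrightarrow> range (trail g q (h \<xi>)) \<subseteq> S"
    and dense: "\<And>\<xi> k s. range (trail f p \<xi>) \<subseteq> L \<Longrightarrow> s \<in> S \<Longrightarrow>
      \<exists>\<xi>'. range (trail f p \<xi>') \<subseteq> L \<and> prefix k \<xi>' = prefix k \<xi> \<and> prefix k (h \<xi>') = prefix k (h \<xi>) \<and>
        (\<exists>n\<ge>k. trail g q (h \<xi>') n = s)"
  obtains \<xi> where "limit (trail f p \<xi>) = L" "range (trail f p \<xi>) \<subseteq> L"
    "limit (trail g q (h \<xi>)) = S"
proof -
  obtain w where w: "set w = L \<times> S"
    using finite_list[of "L \<times> S"] assms(3,5) by auto
  have "w \<noteq> []" using w L \<open>S \<noteq> {}\<close> by auto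
  \<comment> \<open>Repeating an enumeration of \<open>L \<times> S\<close> makes every pair of
    states a target infinitely often.\<close>
  define goal where "goal = iter w"
  have goal_in: "goal n \<in> L \<times> S" for n
    using \<open>w \<noteq> []\<close> unfolding goal_def w[symmetric] by simp
  have goal_lim: "limit goal = L \<times> S" using limit_iter \<open>w \<noteq> []\<close> w by (auto simp: goal_def)
  let ?stay = "\<lambda>\<xi>. range (trail f p \<xi>) \<subseteq> L"
  \<comment> \<open>Stage \<open>n\<close> must preserve the first \<open>k\<close> letters of input
    and output and reach both targets at positions from \<open>k\<close> to below
    \<open>k'\<close>.\<close>
  define next_ok where "next_ok n \<xi> k \<xi>' k' \<longleftrightarrow> k < k' \<and> prefix k \<xi>' = prefix k \<xi> \<and>
      prefix k (h \<xi>') = prefix k (h \<xi>) \<and> (\<exists>m\<ge>k. m < k' \<and> trail f p \<xi>' m = fst (goal n)) \<and>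
      (\<exists>m\<ge>k. m < k' \<and> trail g q (h \<xi>') m = snd (goal n))" for n \<xi> k \<xi>' k'
  have step: "\<exists>\<xi>' k'. ?stay \<xi>' \<and> next_ok n \<xi> k \<xi>' k'" if \<xi>: "?stay \<xi>" for n \<xi> k
  proof -
    \<comment> \<open>The output target comes first: once a prefix of the input has fixed the output
      up to \<open>n1\<close>, the input can be steered freely to its own target.\<close>
    obtain \<xi>1 n1 where 1: "?stay \<xi>1" "prefix k \<xi>1 = prefix k \<xi>" "prefix k (h \<xi>1) = prefix k (h \<xi>)"
      "n1 \<ge> k" "trail g q (h \<xi>1) n1 = snd (goal n)"
      using dense[OF \<xi>, of "snd (goal n)" k] goal_in[of n] by auto
    obtain m where m: "m \<ge> k" "\<And>\<zeta>. prefix n1 (h (prefix m \<xi>1 \<frown> \<zeta>)) = prefix n1 (h \<xi>1)"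
      using cantor_continuous_commit[OF cont, where k = k and n = n1 and \<xi> = \<xi>1] by blast
    have "trail f p \<xi>1 m \<in> L" using 1 by auto
    then obtain v where v: "foldl f (trail f p \<xi>1 m) v = fst (goal n)"
        "visited f (trail f p \<xi>1 m) v \<subseteq> L"
      using strongly_connectedE[OF L(1), of "trail f p \<xi>1 m" "fst (goal n)"] goal_in[of n] by (metis mem_Times_iff)
    have "fst (goal n) \<in> L" using goal_in[of n] by (simp add: mem_Times_iff)
    then obtain \<zeta> where \<zeta>: "range (trail f (fst (goal n)) \<zeta>) \<subseteq> L"
      using strongly_connected_infinite_path[OF L(1)] by blast
    define \<xi>2 where "\<xi>2 = prefix m \<xi>1 \<frown> v \<frown> \<zeta>"
    have p1: "foldl f p (prefix m \<xi>1) = trail f p \<xi>1 m" by (simp add: trail_def)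
    have "visited f p (prefix m \<xi>1) \<subseteq> L"
      using visited_subsequence_trail[of 0 m f p \<xi>1] 1 by auto
    then have stay2: "?stay \<xi>2"
      unfolding \<xi>2_def range_trail_conc p1 v using v \<zeta> by simp
    have \<xi>2': "\<xi>2 = (prefix m \<xi>1 @ v) \<frown> \<zeta>" by (simp add: \<xi>2_def)
    have tr: "trail f p \<xi>2 (m + length v) = fst (goal n)"
      unfolding \<xi>2' trail_def using prefix_conc_length[of "prefix m \<xi>1 @ v" \<zeta>] v(1)
      by (simp add: trail_def)
    have ag: "prefix n1 (h \<xi>2) = prefix n1 (h \<xi>1)" using m(2) \<xi>2_def by metis
    have "prefix m \<xi>2 = prefix m \<xi>1" unfolding \<xi>2_def by simp
    then have ag2: "prefix k \<xi>2 = prefix k \<xi>" using 1(2) m(1) prefix_prefix by metis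
    have ag3: "prefix k (h \<xi>2) = prefix k (h \<xi>)" using ag 1(3,4) prefix_prefix by metis
    have "trail g q (h \<xi>2) n1 = snd (goal n)" using ag 1(5) trail_cong by (metis order_refl)
    then have "next_ok n \<xi> k \<xi>2 (Suc (max (m + length v) n1))"
      unfolding next_ok_def using ag2 ag3 tr m(1) 1(4)
      by (intro conjI exI[of _ "m + length v"] exI[of _ n1]) auto
    then show ?thesis using stay2 by blast
  qed
  have "\<exists>X. \<forall>n. ?stay (fst (X n)) \<and> next_ok n (fst (X n)) (snd (X n)) (fst (X (Suc n))) (snd (X (Suc n)))"
  proof (rule dependent_nat_choice)
    show "\<exists>x. ?stay (fst x)"
      using strongly_connected_infinite_path[OF L(1,3)] by (metis fst_conv)
    show "\<exists>y. ?stay (fst y) \<and> next_ok n (fst x) (snd x) (fst y) (snd y)" if "?stay (fst x)" for x n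
      using step[OF that, of n "snd x"] by (metis fst_conv snd_conv)
  qed
  then obtain X where X: "\<And>n. ?stay (fst (X n))"
    "\<And>n. next_ok n (fst (X n)) (snd (X n)) (fst (X (Suc n))) (snd (X (Suc n)))"
    by blast
  define x where "x = (\<lambda>n. fst (X n))"
  define K where "K = (\<lambda>n. snd (X n))"
  have stay: "?stay (x n)" for n using X x_def by auto
  have nx: "K n < K (Suc n)" "prefix (K n) (x (Suc n)) = prefix (K n) (x n)"
      "prefix (K n) (h (x (Suc n))) = prefix (K n) (h (x n))"
      "\<exists>m\<ge>K n. m < K (Suc n) \<and> trail f p (x (Suc n)) m = fst (goal n)"
      "\<exists>m\<ge>K n. m < K (Suc n) \<and> trail g q (h (x (Suc n))) m = snd (goal n)" for n
    using X(2)[of n] unfolding next_ok_def x_def K_def by auto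
  have "strict_mono K" using nx(1) by (simp add: strict_mono_Suc_iff)
  then have Kge: "K n \<ge> n" for n by (rule strict_mono_imp_increasing)
  have Kmono: "K m \<le> K n" if "m \<le> n" for m n
    using that \<open>strict_mono K\<close> by (simp add: strict_mono_less_eq)
  have agree: "prefix (K m) (x n) = prefix (K m) (x m) \<and> prefix (K m) (h (x n)) = prefix (K m) (h (x m))"
    if "m \<le> n" for m n
    using that
  proof (induction n rule: dec_induct)
    case (step n)
    then show ?case using nx(2,3)[of n] Kmono[of m n] prefix_prefix by (metis less_imp_le_nat)
  qed auto
  \<comment> \<open>Diagonal choice: position \<open>i\<close> is already settled in
    \<open>x (Suc i)\<close> because \<open>i < K (Suc i)\<close>.\<close>
  define \<xi> where "\<xi> = (\<lambda>i. x (Suc i) i)"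
  have \<xi>: "prefix (K n) \<xi> = prefix (K n) (x n)" for n
  proof -
    have "\<xi> i = x n i" if "i < K n" for i
    proof (cases "Suc i \<le> n")
      case True
      then have "prefix (K (Suc i)) (x n) = prefix (K (Suc i)) (x (Suc i))" using agree by blast
      then show ?thesis unfolding \<xi>_def using Kge[of "Suc i"] prefix_eqD[of "x n" "K (Suc i)" "x (Suc i)" i] by simp
    next
      case False
      then have "prefix (K n) (x (Suc i)) = prefix (K n) (x n)" using agree[of n "Suc i"] by auto
      then show ?thesis unfolding \<xi>_def using that prefix_eqD by metis
    qed
    then show ?thesis by (auto simp: subsequence_def)
  qed
  \<comment> \<open>Continuity carries the agreement of the outputs over to the limit word, since
    \<open>\<xi>\<close> agrees with a late \<open>x\<close> on the \<open>m\<close> letters that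
    decide the first \<open>K n\<close> output letters.\<close>
  have h\<xi>: "prefix (K n) (h \<xi>) = prefix (K n) (h (x n))" for n
  proof -
    obtain m where m: "\<And>\<eta>. prefix m \<eta> = prefix m \<xi> \<Longrightarrow> prefix (K n) (h \<eta>) = prefix (K n) (h \<xi>)"
      using cont unfolding cantor_continuous_prefix by metis
    have "m \<le> K (max m n)" using Kge[of "max m n"] by simp
    then have "prefix m (x (max m n)) = prefix m \<xi>" using \<xi>[of "max m n"] prefix_prefix by metis
    then show ?thesis using m agree[of n "max m n"] by (metis max.cobounded2)
  qed
  have st: "?stay \<xi>"
  proof -
    have "trail f p \<xi> n \<in> L" for n
    proof -
      have "trail f p \<xi> n = trail f p (x n) n"
        using trail_cong[OF \<xi>[of n] Kge[of n]] .
      then show ?thesis using stay[of n] by auto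
    qed
    then show ?thesis by auto
  qed
  have goal_inf: "\<exists>n\<ge>N. goal n = y" if "y \<in> L \<times> S" for y N
    using that unfolding goal_lim[symmetric] by (auto simp: limit_iff_frequent INFM_nat_le)
  have "\<exists>m\<ge>N. trail f p \<xi> m = l" if "l \<in> L" for l N
  proof -
    obtain s where "s \<in> S" using \<open>S \<noteq> {}\<close> by auto
    then obtain n where n: "n \<ge> N" "goal n = (l, s)" using goal_inf[of "(l, s)" N] \<open>l \<in> L\<close> by auto
    obtain m where m: "m \<ge> K n" "m < K (Suc n)" "trail f p (x (Suc n)) m = l"
      using nx(4)[of n] n by auto
    then have "trail f p \<xi> m = l" using trail_cong[OF \<xi>[of "Suc n"], of m f p] by simp
    then show ?thesis using m(1) n(1) Kge[of n] by (intro exI[of _ m]) auto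
  qed
  then have "L \<subseteq> limit (trail f p \<xi>)" by (auto simp: limit_iff_frequent INFM_nat_le)
  moreover have "\<exists>m\<ge>N. trail g q (h \<xi>) m = s" if "s \<in> S" for s N
  proof -
    obtain n where n: "n \<ge> N" "goal n = (p, s)" using goal_inf[of "(p, s)" N] \<open>s \<in> S\<close> L(3) by auto
    obtain m where m: "m \<ge> K n" "m < K (Suc n)" "trail g q (h (x (Suc n))) m = s"
      using nx(5)[of n] n by auto
    then have "trail g q (h \<xi>) m = s" using trail_cong[OF h\<xi>[of "Suc n"], of m g q] by simp
    then show ?thesis using m(1) n(1) Kge[of n] by (intro exI[of _ m]) auto
  qed
  then have "S \<subseteq> limit (trail g q (h \<xi>))" by (auto simp: limit_iff_frequent INFM_nat_le)
  ultimately have "limit (trail f p \<xi>) = L" "limit (trail g q (h \<xi>)) = S"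
    using out[OF st] st limit_in_range[of "trail f p \<xi>"] limit_in_range[of "trail g q (h \<xi>)"]
    by (metis order_trans subset_antisym)+
  then show thesis using that st by metis
qed

text \<open>Among the available reductions take one with the fewest output states over inputs
  staying in \<open>L'\<close>. By minimality every residual still reaches all of them, so they form
  a strongly connected set, and a single input realizes \<open>L'\<close> and \<open>S'\<close> as
  limit sets, which forces equal colours. Keeping the reduction for \<open>L\<close> and
  \<open>S\<close> as well allows the output to leave \<open>S'\<close> when the loop
  changes.\<close>

lemma reduces_restrict:
  assumes L': "strongly_connected f L'" "finite L'" "L' \<subseteq> L" "p \<in> L'"
    and red: "reduces L S p q" and "finite S"
  obtains S' where "S' \<subseteq> S" "strongly_connected g S'" "a L' = b S'"
    "\<And>q'. q' \<in> S' \<Longrightarrow> \<exists>w. foldl g q w = q' \<and> visited g q w \<subseteq> S"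
    "\<And>q'. q' \<in> S' \<Longrightarrow> reduces L S p q'"
    "\<And>q'. q' \<in> S' \<Longrightarrow> reduces L' S' p q'"
proof -
  let ?stay = "\<lambda>p \<xi>. range (trail f p \<xi>) \<subseteq> L'"
  define Out where "Out = (\<lambda>(p1, q1, h1). {trail g q1 (h1 \<xi>) n | \<xi> n. ?stay p1 \<xi>})"
  \<comment> \<open>Residuals obtained by reading inside \<open>L'\<close> are again candidates, so
    they compete with the minimal choice.\<close>
  define cand where "cand = (\<lambda>(p1, q1, h1). p1 \<in> L' \<and> reduction L S p1 q1 h1 \<and>
      (\<exists>w. foldl g q w = q1 \<and> visited g q w \<subseteq> S))"
  have OutS: "Out c \<subseteq> S" if "cand c" for c
  proof -
    obtain p1 q1 h1 where c: "c = (p1, q1, h1)" by (cases c)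
    have h1: "reduction L S p1 q1 h1" using that unfolding cand_def c by simp
    have "range (trail g q1 (h1 \<xi>)) \<subseteq> S" if "?stay p1 \<xi>" for \<xi>
      using h1 that L'(3) unfolding reduction_def by blast
    then show ?thesis unfolding Out_def c by auto
  qed
  obtain h where h: "reduction L S p q h" using red reduces_def by blast
  obtain \<xi>0 where \<xi>0: "?stay p \<xi>0" using strongly_connected_infinite_path[OF L'(1,4)] .
  have "range (trail g q (h \<xi>0)) \<subseteq> S" using h \<xi>0 L'(3) unfolding reduction_def by blast
  then have "q \<in> S" by (metis range_subsetD trail_0)
  then have "cand (p, q, h)" unfolding cand_def using h L'(4) by (auto intro: exI[of _ "[]"])
  then obtain c where c: "cand c" "\<And>d. cand d \<Longrightarrow> card (Out c) \<le> card (Out d)"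
    using ex_has_least_nat[of cand _ "\<lambda>d. card (Out d)"] by blast
  obtain p1 q1 h1 where c_eq: "c = (p1, q1, h1)" by (cases c)
  define S' where "S' = Out c"
  have p1: "p1 \<in> L'" and h1: "reduction L S p1 q1 h1"
    and q1: "\<exists>w. foldl g q w = q1 \<and> visited g q w \<subseteq> S"
    using c(1) unfolding cand_def c_eq by auto
  have cont: "cantor_continuous h1" using h1 reduction_def by blast
  have S'S: "S' \<subseteq> S" "finite S'"
    using OutS[OF c(1)] finite_subset[OF _ \<open>finite S\<close>] S'_def by auto
  have in_S': "trail g q1 (h1 \<xi>) n \<in> S'" if "?stay p1 \<xi>" for \<xi> n
    using that unfolding S'_def Out_def c_eq by auto
  have S'E: "\<exists>\<xi> n. ?stay p1 \<xi> \<and> s = trail g q1 (h1 \<xi>) n" if "s \<in> S'" for s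
    using that unfolding S'_def Out_def c_eq by auto
  obtain \<xi>1 where \<xi>1: "?stay p1 \<xi>1" using strongly_connected_infinite_path[OF L'(1) p1] .
  then have q1S': "q1 \<in> S'" using in_S'[OF \<xi>1, of 0] by simp
  have dense: "\<exists>\<xi>'. ?stay p1 \<xi>' \<and> prefix k \<xi>' = prefix k \<xi> \<and> prefix k (h1 \<xi>') = prefix k (h1 \<xi>) \<and>
      (\<exists>n\<ge>k. trail g q1 (h1 \<xi>') n = s)" if \<xi>: "?stay p1 \<xi>" and s: "s \<in> S'" for \<xi> k s
  proof -
    obtain m where m: "m \<ge> k" "\<And>\<zeta>. prefix k (h1 (prefix m \<xi> \<frown> \<zeta>)) = prefix k (h1 \<xi>)"
      using cantor_continuous_commit[OF cont, where k = k and n = k and \<xi> = \<xi>] by blast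
    define u where "u = prefix m \<xi>"
    define v where "v = prefix k (h1 \<xi>)"
    define h2 where "h2 = (\<lambda>\<zeta>. suffix (length v) (h1 (u \<frown> \<zeta>)))"
    have u: "visited f p1 u \<subseteq> L'"
      using visited_subsequence_trail[of 0 m f p1 \<xi>] \<xi> unfolding u_def by auto
    have v: "visited g q1 v \<subseteq> S'"
      using visited_subsequence_trail[of 0 k g q1 "h1 \<xi>"] in_S'[OF \<xi>] unfolding v_def by auto
    have lv: "length v = k" by (simp add: v_def)
    have pre: "prefix (length v) (h1 (u \<frown> \<zeta>)) = v" for \<zeta>
      using m(2) lv u_def v_def by simp
    have h1_eq: "h1 (u \<frown> \<zeta>) = v \<frown> h2 \<zeta>" for \<zeta> by (metis h2_def pre prefix_suffix)
    define d where "d = (foldl f p1 u, foldl g q1 v, h2)"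
    have "reduction L S (foldl f p1 u) (foldl g q1 v) h2"
      unfolding h2_def using reduction_residual[OF h1 _ pre] u L'(3) by blast
    moreover have "foldl f p1 u \<in> L'" using u visited_end[of f p1 u] by blast
    moreover have "\<exists>w. foldl g q w = foldl g q1 v \<and> visited g q w \<subseteq> S"
    proof -
      obtain w where "foldl g q w = q1" "visited g q w \<subseteq> S" using q1 by blast
      then show ?thesis using v S'S by (intro exI[of _ "w @ v"]) (auto simp: visited_append)
    qed
    ultimately have "cand d" unfolding cand_def d_def by auto
    have stay2: "?stay p1 (u \<frown> \<zeta>)" if "?stay (foldl f p1 u) \<zeta>" for \<zeta>
      using that u by (simp add: range_trail_conc)
    have tr: "trail g (foldl g q1 v) (h2 \<zeta>) n = trail g q1 (h1 (u \<frown> \<zeta>)) (k + n)" for \<zeta> n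
      unfolding h1_eq using fun_cong[OF suffix_trail_conc[of v g q1 "h2 \<zeta>"], of n] lv by simp
    have "Out d \<subseteq> S'"
    proof
      fix t assume "t \<in> Out d"
      then obtain \<zeta> n where "?stay (foldl f p1 u) \<zeta>" "t = trail g (foldl g q1 v) (h2 \<zeta>) n"
        unfolding Out_def d_def by auto
      then show "t \<in> S'" using in_S'[OF stay2] tr by simp
    qed
    \<comment> \<open>The residual has no new output states and, by minimality, no fewer; hence
      \<open>s\<close> can still occur after the first \<open>k\<close> letters.\<close>
    moreover have "card S' \<le> card (Out d)" using c(2)[OF \<open>cand d\<close>] S'_def by simp
    ultimately have "Out d = S'" using S'S(2) card_seteq by metis
    then obtain \<zeta> n where \<zeta>: "?stay (foldl f p1 u) \<zeta>" "s = trail g (foldl g q1 v) (h2 \<zeta>) n"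
      using s unfolding Out_def d_def by auto
    have "prefix k (h1 (u \<frown> \<zeta>)) = prefix k (h1 \<xi>)" using m u_def by simp
    moreover have "prefix k (u \<frown> \<zeta>) = prefix k \<xi>"
      using prefix_prefix[of "u \<frown> \<zeta>" m \<xi> k] m(1) by (simp add: u_def)
    moreover have "\<exists>n\<ge>k. trail g q1 (h1 (u \<frown> \<zeta>)) n = s"
      using tr \<zeta> by (metis le_add1)
    ultimately show ?thesis using stay2[OF \<zeta>(1)] by blast
  qed
  have sc: "strongly_connected g S'"
    unfolding strongly_connected_def
  proof (intro conjI ballI)
    show "S' \<noteq> {}" using q1S' by auto
    fix s t assume s: "s \<in> S'" and t: "t \<in> S'"
    obtain \<xi> n where \<xi>: "?stay p1 \<xi>" "s = trail g q1 (h1 \<xi>) n" using S'E[OF s] by blast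
    \<comment> \<open>Asking for \<open>Suc n\<close> rather than \<open>n\<close> makes the word
      between the two positions nonempty.\<close>
    obtain \<xi>' m where \<xi>': "?stay p1 \<xi>'" "prefix (Suc n) (h1 \<xi>') = prefix (Suc n) (h1 \<xi>)"
      "m \<ge> Suc n" "trail g q1 (h1 \<xi>') m = t"
      using dense[OF \<xi>(1) t, of "Suc n"] by blast
    have s': "trail g q1 (h1 \<xi>') n = s" using trail_cong[OF \<xi>'(2), of n] \<xi> by simp
    let ?w = "(h1 \<xi>') [n \<rightarrow> m]"
    have "?w \<noteq> []" using \<xi>'(3) by simp
    moreover have "foldl g s ?w = t"
      using foldl_subsequence_trail[of n m g q1 "h1 \<xi>'"] \<xi>'(3,4) s' by simp
    moreover have "visited g s ?w \<subseteq> S'"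
      using visited_subsequence_trail[of n m g q1 "h1 \<xi>'"] \<xi>'(3) s' in_S'[OF \<xi>'(1)] by auto
    ultimately show "\<exists>w. w \<noteq> [] \<and> foldl g s w = t \<and> visited g s w \<subseteq> S'" by blast
  qed
  \<comment> \<open>One input has both limit sets; evaluating the reduction at it gives the equation
    of the colours.\<close>
  obtain \<xi> where \<xi>: "limit (trail f p1 \<xi>) = L'" "?stay p1 \<xi>" "limit (trail g q1 (h1 \<xi>)) = S'"
  proof (rule generic_word[OF cont L'(1,2) p1 S'S(2), of q1])
    show "S' \<noteq> {}" using q1S' by auto
    show "range (trail g q1 (h1 \<xi>)) \<subseteq> S'" if "?stay p1 \<xi>" for \<xi> using in_S'[OF that] by auto
  qed (use dense in blast)+
  then have col: "a L' = b S'" using h1 L'(3) unfolding reduction_def by (metis order_trans)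
  \<comment> \<open>The minimal choice sits at \<open>p1\<close>; a word inside \<open>L'\<close>
    brings the input back to \<open>p\<close> while nothing is written.\<close>
  obtain u where u: "foldl f p1 u = p" "visited f p1 u \<subseteq> L'"
    using strongly_connectedE[OF L'(1) p1 L'(4)] by blast
  have "reduction L' S' p1 q1 h1"
    using h1 L'(3) in_S' unfolding reduction_def by blast
  then have r1: "reduces L' S' p q1" using reduces_delay u reduces_def by metis
  have r2: "reduces L S p q1" using reduces_delay[of L S p1 q1 u] u L'(3) h1 reduces_def by blast
  show thesis
  proof (rule that[OF S'S(1) sc col])
    fix q' assume q': "q' \<in> S'"
    obtain v where v: "foldl g q' v = q1" "visited g q' v \<subseteq> S'"
      using strongly_connectedE[OF sc q' q1S'] by blast
    show "reduces L S p q'" "reduces L' S' p q'"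
      using reduces_prepend[OF r1 v] reduces_prepend[OF r2 v(1)] v(2) S'S(1) by auto
    obtain w where w: "foldl g q w = q1" "visited g q w \<subseteq> S" using q1 by blast
    obtain v' where v': "foldl g q1 v' = q'" "visited g q1 v' \<subseteq> S'"
      using strongly_connectedE[OF sc q1S' q'] by blast
    show "\<exists>w. foldl g q w = q' \<and> visited g q w \<subseteq> S"
      using w v' S'S(1) by (intro exI[of _ "w @ v'"]) (auto simp: visited_append)
  qed
qed

end

section \<open>The transducer\<close>

definition visit :: "('p \<Rightarrow> 'p set) \<Rightarrow> 'p \<Rightarrow> 'p \<Rightarrow> 'p set" where
  "visit D s = (\<lambda>t. if t = s then {s} else if D t = {} then {} else insert s (D t))"

text \<open>The situation of a run that has passed through all of \<open>V\<close> while staying in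
  \<open>V\<close>: each record it consults is then a nonempty subset of \<open>V\<close>.\<close>

definition tracks :: "'p set \<Rightarrow> ('p \<Rightarrow> 'p set) \<Rightarrow> bool" where
  "tracks V D \<longleftrightarrow> (\<forall>s\<in>V. s \<in> D s \<and> D s \<subseteq> V)"

lemma tracks_visit: "tracks V D \<Longrightarrow> s \<in> V \<Longrightarrow> tracks V (visit D s)"
  by (auto simp: tracks_def visit_def)

lemma foldl_visit_notin:
  "s \<notin> set ps \<Longrightarrow> foldl visit D ps s = (if D s = {} then {} else D s \<union> set ps)"
  by (induction ps rule: rev_induct) (auto simp: visit_def)

text \<open>The last occurrence of \<open>s\<close> in \<open>ps\<close> resets its record, so
  nothing earlier is remembered.\<close>

lemma foldl_visit_in: "s \<in> set ps \<Longrightarrow> foldl visit D ps s = foldl visit D' ps s"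
  by (induction ps rule: rev_induct) (auto simp: visit_def foldl_visit_notin)

lemma tracks_foldl_visit: "tracks (set ps) (foldl visit D ps)"
proof -
  have "s \<in> foldl visit D ps s \<and> foldl visit D ps s \<subseteq> set ps" if "s \<in> set ps" for s
    using that by (induction ps rule: rev_induct) (auto simp: visit_def foldl_visit_notin)
  then show ?thesis by (simp add: tracks_def)
qed

text \<open>States on \<open>ps\<close> are reset in the second round; the others, if their record
  is nonempty, have absorbed \<open>set ps\<close> in the first round already.\<close>

lemma foldl_visit_idem: "foldl visit (foldl visit D ps) ps = foldl visit D ps"
proof
  fix s
  show "foldl visit (foldl visit D ps) ps s = foldl visit D ps s"
  proof (cases "s \<in> set ps")
    case False
    then show ?thesis by (auto simp: foldl_visit_notin)
  qed (rule foldl_visit_in)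
qed

text \<open>Here \<open>s\<close> is the state whose first occurrence in \<open>ps\<close> comes
  last.\<close>

lemma split_last_new:
  assumes "ps \<noteq> []"
  obtains ps1 s ps2 where "ps = ps1 @ s # ps2" "s \<notin> set ps1" "insert s (set ps1) = set ps"
  using assms
proof (induction ps arbitrary: thesis rule: rev_induct)
  case (snoc y ps)
  show ?case
  proof (cases "y \<in> set ps")
    case True
    then have "ps \<noteq> []" by auto
    then obtain ps1 s ps2 where "ps = ps1 @ s # ps2" "s \<notin> set ps1" "insert s (set ps1) = set ps"
      using snoc.IH by blast
    then show ?thesis using snoc.prems(1)[of ps1 s "ps2 @ [y]"] True by auto
  next
    case False
    then show ?thesis using snoc.prems(1)[of ps y "[]"] by auto
  qed
qed simp

text \<open>Take the state whose first occurrence comes last. Until then its record is not reset, so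
  it collects every other state of \<open>ps\<close>.\<close>

lemma tracks_full_hit:
  assumes "tracks (set ps) D" "ps \<noteq> []"
  obtains ps1 s ps2 where "ps = ps1 @ s # ps2" "foldl visit D ps1 s = set ps"
proof -
  obtain ps1 s ps2 where s: "ps = ps1 @ s # ps2" "s \<notin> set ps1" "insert s (set ps1) = set ps"
    using split_last_new[OF assms(2)] .
  have "s \<in> D s" "D s \<subseteq> set ps" using assms(1) s unfolding tracks_def by auto
  then have "foldl visit D ps1 s = set ps" using s by (auto simp: foldl_visit_notin)
  then show thesis using that s(1) by blast
qed

text \<open>Omits the start state, unlike \<open>visited\<close>, because \<open>step\<close> enters
  into the record the state just reached.\<close>

fun path :: "('s \<Rightarrow> 'a \<Rightarrow> 's) \<Rightarrow> 's \<Rightarrow> 'a list \<Rightarrow> 's list" where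
  "path f s [] = []"
| "path f s (x # w) = f s x # path f (f s x) w"

lemma length_path [simp]: "length (path f s w) = length w"
  by (induction w arbitrary: s) auto

lemma path_append: "path f s (u @ v) = path f s u @ path f (foldl f s u) v"
  by (induction u arbitrary: s) auto

lemma path_split:
  assumes "path f s w = ps1 @ t # ps2"
  obtains u x v where "w = u @ x # v" "path f s u = ps1" "f (foldl f s u) x = t"
proof -
  let ?n = "length ps1"
  have n: "?n < length w" using arg_cong[OF assms, of length] by simp
  have w: "w = take ?n w @ w ! ?n # drop (Suc ?n) w" using n by (rule id_take_nth_drop)
  have "ps1 @ t # ps2 = path f s (take ?n w) @
      path f (foldl f s (take ?n w)) (w ! ?n # drop (Suc ?n) w)"
    using assms w by (metis path_append)
  then have "path f s (take ?n w) = ps1" "f (foldl f s (take ?n w)) (w ! ?n) = t"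
    using n by (simp_all add: append_eq_append_conv)
  then show thesis using that w by blast
qed

lemma path_subsequence: "m \<le> n \<Longrightarrow> path f (trail f s \<xi> m) (\<xi> [m \<rightarrow> n]) = map (trail f s \<xi>) [Suc m..<Suc n]"
proof (induction n rule: dec_induct)
  case (step n)
  then show ?case
    by (simp add: path_append foldl_subsequence_trail trail_Suc)
qed auto

lemma path_power:
  "foldl f s u = s \<Longrightarrow> path f s (concat (replicate n u)) = concat (replicate n (path f s u))"
  by (induction n) (auto simp: path_append)

section \<open>The memory of the transducer and its invariants\<close>

locale reducible_pair = aut_pair f g a b
  for f :: "'p \<Rightarrow> 'a \<Rightarrow> 'p" and g :: "'q \<Rightarrow> 'a \<Rightarrow> 'q"
    and a :: "'p set \<Rightarrow> 'c" and b :: "'q set \<Rightarrow> 'c" +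
  fixes P :: "'p set" and Q :: "'q set" and p0 :: 'p and q0 :: 'q
  assumes finite_P: "finite P" and finite_Q: "finite Q"
    and p0: "p0 \<in> P" and q0: "q0 \<in> Q" and f_closed: "\<And>p x. p \<in> P \<Longrightarrow> f p x \<in> P"
    and start: "reduces P Q p0 q0"
begin

text \<open>These are the conclusions of \<open>reduces_restrict\<close> for the pair
  \<open>y\<close> and the loop \<open>H\<close>, collected so that \<open>push\<close> can choose
  such an \<open>S'\<close>.\<close>

definition refines :: "'p \<Rightarrow> 'q \<Rightarrow> 'p set \<times> 'q set \<Rightarrow> 'p set \<Rightarrow> 'q set \<Rightarrow> bool" where
  "refines p q y H S' \<longleftrightarrow> S' \<subseteq> snd y \<and> strongly_connected g S' \<and> a H = b S' \<and>
     (\<forall>q'\<in>S'. (\<exists>w. foldl g q w = q' \<and> visited g q w \<subseteq> snd y) \<and>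
        reduces (fst y) (snd y) p q' \<and> reduces H S' p q')"

definition base :: "'q set \<Rightarrow> 'q" where
  "base S = (SOME s. s \<in> S)"

text \<open>The word may pass outside \<open>S'\<close> but stays inside \<open>S\<close>, the
  output part of the enclosing level, so no enclosing level is violated.\<close>

definition tour :: "'q \<Rightarrow> 'q set \<Rightarrow> 'q set \<Rightarrow> 'a list" where
  "tour q S S' = (SOME w. w \<noteq> [] \<and> foldl g q w = base S' \<and> S' \<subseteq> visited g q w \<and> visited g q w \<subseteq> S)"

definition top_level :: "('p set \<times> 'q set) list \<Rightarrow> 'p set \<times> 'q set" where
  "top_level st = (case st of [] \<Rightarrow> (P, Q) | y # _ \<Rightarrow> y)"

definition pop :: "'p set \<Rightarrow> ('p set \<times> 'q set) list \<Rightarrow> ('p set \<times> 'q set) list" where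
  "pop H st = dropWhile (\<lambda>y. \<not> H \<subseteq> fst y) st"

text \<open>An existing level for \<open>H\<close> is kept, so that a persistent level retains its
  second component.\<close>

definition push :: "'p \<Rightarrow> 'q \<Rightarrow> 'p set \<Rightarrow> ('p set \<times> 'q set) list \<Rightarrow> ('p set \<times> 'q set) list" where
  "push p q H st = (if st \<noteq> [] \<and> fst (hd st) = H then st
     else (H, SOME S'. refines p q (top_level st) H S') # st)"

text \<open>In a memory \<open>(p, D, st, q)\<close>, \<open>p\<close> and \<open>q\<close> are the states reached by the input and the output,
  \<open>D s\<close> is the set of input states seen since the last visit of \<open>s\<close> (empty if \<open>s\<close> has not been
  visited), and \<open>st\<close> is the stack with the innermost level first, on top of an implicit level
  \<open>(P, Q)\<close>. Ending every tour at a base point that depends on the level alone is what makes the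
  memory after a full loop independent of the past.\<close>

type_synonym (in -) ('x, 'y) memory = "'x \<times> ('x \<Rightarrow> 'x set) \<times> ('x set \<times> 'y set) list \<times> 'y"

text \<open>A first visit closes no loop: the stack is emptied, leaving the implicit level
  \<open>(P, Q)\<close>, and \<open>out\<close> writes nothing.\<close>

fun step :: "('p, 'q) memory \<Rightarrow> 'a \<Rightarrow> ('p, 'q) memory" where
  "step (p, D, st, q) x =
     (if D (f p x) = {} then (f p x, visit D (f p x), [], q)
      else let st' = push (f p x) q (D (f p x)) (pop (D (f p x)) st)
        in (f p x, visit D (f p x), st', base (snd (hd st'))))"

fun out :: "('p, 'q) memory \<Rightarrow> 'a \<Rightarrow> 'a list" where
  "out (p, D, st, q) x =
     (if D (f p x) = {} then []
      else let st' = pop (D (f p x)) st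
        in tour q (snd (top_level st')) (snd (hd (push (f p x) q (D (f p x)) st'))))"

definition good_level :: "'p \<Rightarrow> 'q \<Rightarrow> 'p set \<times> 'q set \<Rightarrow> bool" where
  "good_level p q y \<longleftrightarrow> fst y \<subseteq> P \<and> snd y \<subseteq> Q \<and> p \<in> fst y \<and> q \<in> snd y \<and>
     strongly_connected g (snd y) \<and> a (fst y) = b (snd y) \<and> reduces (fst y) (snd y) p q"

text \<open>Strict growth of the input parts makes the levels distinct, so only finitely many stacks
  over \<open>P\<close> and \<open>Q\<close> are possible.\<close>

definition good_stack :: "'p \<Rightarrow> 'q \<Rightarrow> ('p set \<times> 'q set) list \<Rightarrow> bool" where
  "good_stack p q st \<longleftrightarrow> p \<in> P \<and> q \<in> Q \<and> reduces P Q p q \<and> (\<forall>y\<in>set st. good_level p q y) \<and>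
     sorted_wrt (\<lambda>y z. fst y \<subset> fst z \<and> snd y \<subseteq> snd z) st"

text \<open>The word \<open>w\<close> turns the record of the state entered next into an actual loop
  of the automaton.\<close>

definition good_record :: "'p \<Rightarrow> ('p \<Rightarrow> 'p set) \<Rightarrow> bool" where
  "good_record p D \<longleftrightarrow> (\<forall>s. D s \<noteq> {} \<longrightarrow> s \<in> P \<and> D s \<subseteq> P \<and>
     (\<exists>w. foldl f s w = p \<and> visited f s w = D s))"

fun good_memory :: "('p, 'q) memory \<Rightarrow> bool" where
  "good_memory (p, D, st, q) \<longleftrightarrow> good_stack p q st \<and> good_record p D"

lemma good_record_visit:
  assumes D: "good_record p D" and p: "p \<in> P"
  shows "good_record (f p x) (visit D (f p x))"
  unfolding good_record_def
proof (intro allI impI)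
  fix s
  let ?p' = "f p x"
  assume ne: "visit D ?p' s \<noteq> {}"
  show "s \<in> P \<and> visit D ?p' s \<subseteq> P \<and> (\<exists>w. foldl f s w = ?p' \<and> visited f s w = visit D ?p' s)"
  proof (cases "s = ?p'")
    case True
    then show ?thesis using f_closed[OF p] by (auto simp: visit_def intro!: exI[of _ "[]"])
  next
    case False
    then have Ds: "D s \<noteq> {}" "visit D ?p' s = insert ?p' (D s)" using ne by (auto simp: visit_def)
    then obtain w where w: "foldl f s w = p" "visited f s w = D s" and P: "s \<in> P" "D s \<subseteq> P"
      using D unfolding good_record_def by blast
    have "foldl f s (w @ [x]) = ?p'" "visited f s (w @ [x]) = insert ?p' (D s)"
      using w visited_end[of f s w] by (auto simp: visited_append)
    then show ?thesis using Ds P f_closed[OF p] by (metis insert_subset)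
  qed
qed

text \<open>The word behind the record of \<open>f p x\<close> leads back to \<open>p\<close>;
  followed by \<open>x\<close> it is a cycle through exactly the recorded states.\<close>

lemma hit_connected:
  assumes "good_record p D" "D (f p x) \<noteq> {}"
  shows "strongly_connected f (D (f p x))" "D (f p x) \<subseteq> P" "p \<in> D (f p x)" "f p x \<in> D (f p x)"
proof -
  let ?s = "f p x"
  obtain w where w: "foldl f ?s w = p" "visited f ?s w = D ?s" and P: "D ?s \<subseteq> P"
    using assms unfolding good_record_def by blast
  show "D ?s \<subseteq> P" by (fact P)
  show p: "p \<in> D ?s" using w visited_end[of f ?s w] by simp
  show s: "?s \<in> D ?s" using w visited_start[of ?s f w] by simp
  have "visited f ?s (w @ [x]) = D ?s" using w p s by (auto simp: visited_append)
  then show "strongly_connected f (D ?s)"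
    using strongly_connected_cycle[of "w @ [x]" f ?s] w by simp
qed

lemma base_in: "strongly_connected g S \<Longrightarrow> base S \<in> S"
  unfolding base_def strongly_connected_def by (metis ex_in_conv someI)

text \<open>As the stack is sorted, dropping up to the first level containing \<open>H\<close>
  leaves only such levels. They contain \<open>p\<close> and \<open>f p x\<close>, so each reduction
  survives reading \<open>x\<close> without output.\<close>

lemma pop_props:
  assumes "good_stack p q st" and H: "f p x \<in> H" "p \<in> H" "H \<subseteq> P"
  shows "\<forall>y\<in>set (pop H st). H \<subseteq> fst y" and "good_stack (f p x) q (pop H st)"
proof -
  let ?st = "pop H st"
  have sorted: "sorted_wrt (\<lambda>y z. fst y \<subset> fst z \<and> snd y \<subseteq> snd z) ?st"
    using assms(1) unfolding good_stack_def pop_def by (auto intro: sorted_wrt_dropWhile)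
  show sup: "\<forall>y\<in>set ?st. H \<subseteq> fst y"
  proof (cases ?st)
    case (Cons y ys)
    then have "H \<subseteq> fst y" unfolding pop_def by (metis dropWhile_eq_Cons_conv)
    then show ?thesis using sorted Cons by auto
  qed simp
  have sub: "set ?st \<subseteq> set st" unfolding pop_def by (meson set_dropWhileD subsetI)
  have red: "reduces K S (f p x) q" if "reduces K S p q" "H \<subseteq> K" for K S
    using reduces_delay[OF that(1), of "[x]"] that(2) H by auto
  have "good_level (f p x) q y" if "y \<in> set ?st" for y
  proof -
    have "good_level p q y" "H \<subseteq> fst y"
      using that sub sup assms(1) unfolding good_stack_def by auto
    then show ?thesis using red[of "fst y" "snd y"] H unfolding good_level_def by auto
  qed
  moreover have "reduces P Q (f p x) q" using assms(1) red H(3) unfolding good_stack_def by blast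
  ultimately show "good_stack (f p x) q ?st"
    using sorted assms(1) H unfolding good_stack_def by blast
qed

text \<open>The innermost output set is strongly connected and contained in all others, so the
  output can return from \<open>q'\<close> to \<open>q\<close> at every level at once.\<close>

lemma good_stack_move:
  assumes st: "good_stack p q st" and ne: "st \<noteq> []" and q': "q' \<in> snd (hd st)"
  shows "good_stack p q' st"
proof -
  obtain y ys where st_eq: "st = y # ys" using ne by (cases st) auto
  have y: "good_level p q y" using st st_eq unfolding good_stack_def by auto
  then obtain v where v: "foldl g q' v = q" "visited g q' v \<subseteq> snd y"
    using q' st_eq unfolding good_level_def by (auto elim: strongly_connectedE)
  have sub: "snd y \<subseteq> snd z" if "z \<in> set st" for z
    using that st st_eq unfolding good_stack_def by auto
  have "good_level p q' z" if z: "z \<in> set st" for z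
    using z st sub[OF z] v q' st_eq reduces_prepend[of "fst z" "snd z" p q q' v]
    unfolding good_stack_def good_level_def by auto
  moreover have "snd y \<subseteq> Q" using y unfolding good_level_def by blast
  ultimately show ?thesis
    using st v q' st_eq reduces_prepend[of P Q p q q' v] unfolding good_stack_def by auto
qed

text \<open>If the popped stack starts with a level for \<open>H\<close>, that level is toured
  again; otherwise \<open>reduces_restrict\<close>, applied to the top level, supplies a new one.
  These are the two alternatives for \<open>T\<close>.\<close>

lemma hit_step:
  assumes good_memory: "good_memory (p, D, st, q)" and H: "D (f p x) = H" "H \<noteq> {}"
  obtains S T where "step (p, D, st, q) x = (f p x, visit D (f p x), (H, S) # T, base S)"
    "(H, S) # T = pop H st \<or> T = pop H st"
    "out (p, D, st, q) x \<noteq> []" "foldl g q (out (p, D, st, q) x) = base S"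
    "S \<subseteq> visited g q (out (p, D, st, q) x)"
    "visited g q (out (p, D, st, q) x) \<subseteq> snd (top_level (pop H st))"
    "good_memory (step (p, D, st, q) x)"
proof -
  let ?s = "f p x" and ?st = "pop H st"
  let ?st' = "push ?s q H ?st"
  have gs: "good_stack p q st" and D: "good_record p D" using good_memory by auto
  note conn = hit_connected[OF D, of x, unfolded H(1), OF H(2)]
  have D': "good_record ?s (visit D ?s)"
    using good_record_visit[OF D] gs unfolding good_stack_def by blast
  have sup: "\<forall>y\<in>set ?st. H \<subseteq> fst y" and gst: "good_stack ?s q ?st"
    using pop_props[OF gs, of x H] conn by auto
  have finS: "finite S" if "S \<subseteq> Q" for S using finite_subset[OF that finite_Q] .
  have step_eq: "step (p, D, st, q) x = (?s, visit D ?s, ?st', base (snd (hd ?st')))"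
    and out_eq: "out (p, D, st, q) x = tour q (snd (top_level ?st)) (snd (hd ?st'))"
    using H by (simp_all add: Let_def)
  have "\<exists>S T. ?st' = (H, S) # T \<and> ((H, S) # T = ?st \<or> T = ?st) \<and> strongly_connected g S \<and>
      S \<subseteq> Q \<and> S \<subseteq> snd (top_level ?st) \<and> good_stack ?s (base S) ?st' \<and>
      (\<exists>q'\<in>S. \<exists>w. foldl g q w = q' \<and> visited g q w \<subseteq> snd (top_level ?st))"
  proof (cases "?st \<noteq> [] \<and> fst (hd ?st) = H")
    case True
    then obtain S T where st: "?st = (H, S) # T" by (cases ?st) auto
    then have st': "?st' = ?st" "top_level ?st = (H, S)" by (auto simp: push_def top_level_def)
    have y: "good_level ?s q (H, S)" using gst st unfolding good_stack_def by auto
    then have "base S \<in> S" "q \<in> S" "strongly_connected g S" "S \<subseteq> Q"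
      unfolding good_level_def using base_in by auto
    then show ?thesis
      using st st' good_stack_move[OF gst, of "base S"]
      by (intro exI[of _ S] exI[of _ T]) (auto intro!: bexI[of _ q] exI[of _ "[]"])
  next
    case False
    obtain L R where top_eq: "top_level ?st = (L, R)" by (cases "top_level ?st")
    \<comment> \<open>For an empty stack the enclosing level is the implicit
      \<open>(P, Q)\<close>.\<close>
    have LR: "H \<subseteq> L" "reduces L R ?s q" "R \<subseteq> Q"
      using top_eq sup gst conn unfolding top_level_def good_stack_def good_level_def
      by (auto split: list.splits)
    have "finite H" using conn(2) finite_P finite_subset by blast
    then obtain S' where "S' \<subseteq> R" "strongly_connected g S'" "a H = b S'"
      "\<And>q'. q' \<in> S' \<Longrightarrow> \<exists>w. foldl g q w = q' \<and> visited g q w \<subseteq> R"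
      "\<And>q'. q' \<in> S' \<Longrightarrow> reduces L R ?s q'" "\<And>q'. q' \<in> S' \<Longrightarrow> reduces H S' ?s q'"
      using reduces_restrict[OF conn(1) _ LR(1) conn(4) LR(2) finS[OF LR(3)]] by metis
    then have "refines ?s q (top_level ?st) H S'" unfolding refines_def top_eq by simp
    define S where "S = (SOME S'. refines ?s q (top_level ?st) H S')"
    have ref: "refines ?s q (L, R) H S"
      unfolding S_def top_eq[symmetric] using \<open>refines ?s q (top_level ?st) H S'\<close> by (rule someI)
    then have S: "S \<subseteq> R" "strongly_connected g S" "a H = b S" unfolding refines_def by auto
    have st': "?st' = (H, S) # ?st" using False by (auto simp: push_def S_def)
    have bS: "base S \<in> S" using base_in[OF S(2)] .
    then have rb: "reduces L R ?s (base S)" "reduces H S ?s (base S)"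
      "\<exists>w. foldl g q w = base S \<and> visited g q w \<subseteq> R"
      using ref unfolding refines_def by auto
    have gst2: "good_stack ?s (base S) ?st"
    proof (cases "?st = []")
      case True
      then show ?thesis using gst rb(1) top_eq S(1) LR(3) bS unfolding good_stack_def top_level_def by auto
    next
      case False
      then show ?thesis
        using good_stack_move[OF gst False, of "base S"] top_eq bS S(1)
        unfolding top_level_def by (auto split: list.splits)
    qed
    have "good_level ?s (base S) (H, S)"
      using S LR(3) conn bS rb unfolding good_level_def by auto
    moreover have "\<forall>z\<in>set ?st. H \<subset> fst z \<and> S \<subseteq> snd z"
    proof (cases ?st)
      case (Cons y ys)
      have "H \<subset> fst y" using sup False Cons by auto
      moreover have "\<forall>z\<in>set ys. fst y \<subset> fst z \<and> snd y \<subseteq> snd z"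
        using gst Cons unfolding good_stack_def by simp
      moreover have "S \<subseteq> snd y" using S(1) top_eq Cons unfolding top_level_def by simp
      ultimately show ?thesis using Cons by (metis psubset_trans set_ConsD subset_trans)
    qed simp
    ultimately have "good_stack ?s (base S) ?st'"
      using gst2 unfolding st' good_stack_def by auto
    then show ?thesis
      using st' S LR(3) top_eq bS rb(3)
      by (intro exI[of _ S] exI[of _ ?st]) auto
  qed
  then obtain S T where ST: "?st' = (H, S) # T" "(H, S) # T = ?st \<or> T = ?st" "strongly_connected g S"
    "S \<subseteq> Q" "S \<subseteq> snd (top_level ?st)" "good_stack ?s (base S) ?st'"
    and "\<exists>q'\<in>S. \<exists>w. foldl g q w = q' \<and> visited g q w \<subseteq> snd (top_level ?st)"
    by blast
  then obtain w where w: "foldl g q w \<in> S" "visited g q w \<subseteq> snd (top_level ?st)" by auto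
  obtain v where v: "v \<noteq> []" "foldl g (foldl g q w) v = base S" "visited g (foldl g q w) v = S"
    using strongly_connected_tour[OF ST(3) finS[OF ST(4)] w(1) base_in[OF ST(3)]] .
  define W where "W = tour q (snd (top_level ?st)) S"
  \<comment> \<open>A way from \<open>q\<close> into \<open>S\<close> followed by a full tour of
    \<open>S\<close> shows that the choice in \<open>tour\<close> succeeds.\<close>
  have "W \<noteq> [] \<and> foldl g q W = base S \<and> S \<subseteq> visited g q W \<and> visited g q W \<subseteq> snd (top_level ?st)"
    unfolding W_def tour_def
    by (rule someI[of _ "w @ v"]) (use v w ST(5) in \<open>auto simp: visited_append\<close>)
  moreover have "out (p, D, st, q) x = W" using out_eq ST(1) W_def by simp
  ultimately show thesis using that[of S T] step_eq ST D' by simp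
qed

lemma good_memory_step: "good_memory \<sigma> \<Longrightarrow> good_memory (step \<sigma> x)"
proof -
  assume good_memory: "good_memory \<sigma>"
  obtain p D st q where \<sigma>: "\<sigma> = (p, D, st, q)" by (cases \<sigma>)
  show ?thesis
  proof (cases "D (f p x) = {}")
    case True
    have gs: "good_stack p q st" and D: "good_record p D" using good_memory \<sigma> by auto
    then have p: "p \<in> P" unfolding good_stack_def by blast
    have "reduces P Q (f p x) q"
      using reduces_delay[of P Q p q "[x]"] gs f_closed[OF p] p unfolding good_stack_def by auto
    then show ?thesis
      using True \<sigma> good_record_visit[OF D p] gs f_closed[OF p] by (simp add: good_stack_def)
  next
    case False
    then show ?thesis using hit_step good_memory \<sigma> by metis
  qed
qed

lemma foldl_out_step: "good_memory \<sigma> \<Longrightarrow> foldl g (snd (snd (snd \<sigma>))) (out \<sigma> x) = snd (snd (snd (step \<sigma> x)))"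
proof -
  assume good_memory: "good_memory \<sigma>"
  obtain p D st q where \<sigma>: "\<sigma> = (p, D, st, q)" by (cases \<sigma>)
  show ?thesis
  proof (cases "D (f p x) = {}")
    case True
    then show ?thesis using \<sigma> by simp
  next
    case False
    obtain S T where "step (p, D, st, q) x = (f p x, visit D (f p x), (D (f p x), S) # T, base S)"
      "foldl g q (out (p, D, st, q) x) = base S"
      using hit_step[of p D st q x, OF _ refl False] good_memory \<sigma> by metis
    then show ?thesis using \<sigma> by (metis snd_conv)
  qed
qed

text \<open>With \<open>tracks V D\<close>, entering a state of \<open>V\<close> closes a loop
  inside \<open>V\<close>, which never pops the level for \<open>V\<close>; \<open>U\<close> holds
  levels for smaller loops.\<close>

fun anchored :: "'p set \<Rightarrow> 'q set \<Rightarrow> ('p set \<times> 'q set) list \<Rightarrow> ('p, 'q) memory \<Rightarrow> bool" where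
  "anchored V S T (p, D, st, q) \<longleftrightarrow> tracks V D \<and> (\<exists>U. st = U @ (V, S) # T \<and> (\<forall>y\<in>set U. fst y \<subset> V))"

lemma pop_anchored:
  "H \<subseteq> V \<Longrightarrow> \<exists>U'. pop H (U @ (V, S) # T) = U' @ (V, S) # T \<and> set U' \<subseteq> set U"
  unfolding pop_def
proof (induction U)
  case (Cons y U)
  show ?case
  proof (cases "H \<subseteq> fst y")
    case True
    then show ?thesis by (intro exI[of _ "y # U"]) simp
  next
    case False
    then show ?thesis using Cons by auto
  qed
qed auto


lemma foldl_step_fst: "fst (foldl step \<sigma> w) = foldl f (fst \<sigma>) w"
proof (induction w arbitrary: \<sigma>)
  case (Cons x w)
  obtain p D st q where "\<sigma> = (p, D, st, q)" by (cases \<sigma>)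
  then have "fst (step \<sigma> x) = f (fst \<sigma>) x" by (simp add: Let_def)
  then show ?case using Cons by simp
qed simp

lemma foldl_step_record:
  "fst (snd (foldl step \<sigma> w)) = foldl visit (fst (snd \<sigma>)) (path f (fst \<sigma>) w)"
proof (induction w arbitrary: \<sigma>)
  case (Cons x w)
  obtain p D st q where "\<sigma> = (p, D, st, q)" by (cases \<sigma>)
  then have "fst (step \<sigma> x) = f (fst \<sigma>) x" "fst (snd (step \<sigma> x)) = visit (fst (snd \<sigma>)) (f (fst \<sigma>) x)"
    by (simp_all add: Let_def)
  then show ?case using Cons by simp
qed simp

lemma good_memory_foldl_step: "good_memory \<sigma> \<Longrightarrow> good_memory (foldl step \<sigma> w)"
  by (induction w arbitrary: \<sigma>) (auto simp: good_memory_step simp del: step.simps good_memory.simps)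

text \<open>The tour stays in the output part of the anchor or of a level above it, hence inside
  \<open>S\<close>. A full loop removes \<open>U\<close>, and the resulting memory no longer depends
  on \<open>U\<close> or \<open>q\<close>.\<close>

lemma anchored_step:
  assumes good_memory: "good_memory (p, D, st, q)" and anch: "anchored V S T (p, D, st, q)" and V: "f p x \<in> V"
  shows "anchored V S T (step (p, D, st, q) x)"
    and "visited g q (out (p, D, st, q) x) \<subseteq> S"
    and "D (f p x) = V \<Longrightarrow> step (p, D, st, q) x = (f p x, visit D (f p x), (V, S) # T, base S) \<and>
      S \<subseteq> visited g q (out (p, D, st, q) x) \<and> out (p, D, st, q) x \<noteq> []"
proof -
  let ?H = "D (f p x)" and ?w = "out (p, D, st, q) x"
  obtain U where D: "tracks V D" and st: "st = U @ (V, S) # T" and U: "\<forall>y\<in>set U. fst y \<subset> V"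
    using anch by auto
  have H: "?H \<noteq> {}" "?H \<subseteq> V" using D V unfolding tracks_def by auto
  obtain S' T' where step: "step (p, D, st, q) x = (f p x, visit D (f p x), (?H, S') # T', base S')"
    "(?H, S') # T' = pop ?H st \<or> T' = pop ?H st" "?w \<noteq> []"
    "S' \<subseteq> visited g q ?w" "visited g q ?w \<subseteq> snd (top_level (pop ?H st))"
    "good_memory (step (p, D, st, q) x)"
    using hit_step[OF good_memory refl H(1)] by metis
  obtain U' where U': "pop ?H st = U' @ (V, S) # T" "set U' \<subseteq> set U"
    using pop_anchored[OF H(2)] st by metis
  have "snd (top_level (pop ?H st)) \<subseteq> S"
  proof (cases U')
    case Nil
    then show ?thesis using U' by (simp add: top_level_def)
  next
    case (Cons y ys)
    then have "y \<in> set U" using U' by auto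
    then have "snd y \<subseteq> S" using good_memory unfolding st by (auto simp: good_stack_def sorted_wrt_append)
    then show ?thesis using U' Cons by (simp add: top_level_def)
  qed
  then show "visited g q ?w \<subseteq> S" using step by blast
  have "sorted_wrt (\<lambda>y z. fst y \<subset> fst z \<and> snd y \<subseteq> snd z) ((?H, S') # T')"
    using step(1,6) by (simp add: good_stack_def)
  \<comment> \<open>Strict growth forbids two levels with the same input part, so for
    \<open>?H = V\<close> no second level for \<open>V\<close> is pushed.\<close>
  then have above: "?H \<subset> fst z" if "z \<in> set T'" for z using that by auto
  have anch': "(?H = V \<longrightarrow> S' = S \<and> T' = T) \<and>
      (\<exists>W. (?H, S') # T' = W @ (V, S) # T \<and> (\<forall>y\<in>set W. fst y \<subset> V))"
  proof (cases "T' = pop ?H st")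
    case True
    then have "?H \<subset> V" using above[of "(V, S)"] U' by auto
    then show ?thesis using True U' U by (intro conjI exI[of _ "(?H, S') # U'"]) auto
  next
    case False
    then have eq: "(?H, S') # T' = U' @ (V, S) # T" using step(2) U' by simp
    have "S' = S \<and> T' = T" if "?H = V"
    proof (cases U')
      case Nil
      then show ?thesis using eq by simp
    next
      case (Cons y ys)
      then have "fst y = V" "y \<in> set U" using eq that U' by auto
      then show ?thesis using U by blast
    qed
    then show ?thesis using eq U' U by blast
  qed
  then show "anchored V S T (step (p, D, st, q) x)"
    using step(1) tracks_visit[OF D V] by simp
  show "step (p, D, st, q) x = (f p x, visit D (f p x), (V, S) # T, base S) \<and> S \<subseteq> visited g q ?w \<and> ?w \<noteq> []"
    if "?H = V"
    using anch' that step by simp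
qed

lemma anchored_foldl_step:
  assumes "good_memory \<sigma>" "anchored V S T \<sigma>" "set (path f (fst \<sigma>) w) \<subseteq> V"
  shows "anchored V S T (foldl step \<sigma> w)"
  using assms
proof (induction w arbitrary: \<sigma>)
  case (Cons x w)
  obtain p D st q where \<sigma>: "\<sigma> = (p, D, st, q)" by (cases \<sigma>)
  have "fst (step \<sigma> x) = f (fst \<sigma>) x" using foldl_step_fst[of \<sigma> "[x]"] by simp
  moreover have "anchored V S T (step \<sigma> x)"
    using anchored_step(1)[of p D st q V S T x] Cons.prems \<sigma> by simp
  ultimately show ?case using Cons.IH[of "step \<sigma> x"] Cons.prems good_memory_step by simp
qed simp

text \<open>A full loop through \<open>V\<close> puts a level for \<open>V\<close> on top of the
  stack; the equation of its colours is part of \<open>good_level\<close>.\<close>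

lemma anchored_start:
  assumes good_memory: "good_memory (p, D, st, q)" and V: "tracks V D" "f p x \<in> V" "D (f p x) = V"
  obtains S T where "step (p, D, st, q) x = (f p x, visit D (f p x), (V, S) # T, base S)"
    "anchored V S T (step (p, D, st, q) x)" "a V = b S"
proof -
  have ne: "V \<noteq> {}" using V by auto
  obtain S T where step: "step (p, D, st, q) x = (f p x, visit D (f p x), (V, S) # T, base S)"
      "good_memory (step (p, D, st, q) x)"
    using hit_step[OF good_memory V(3) ne] by metis
  moreover have "a V = b S" using step by (simp add: good_stack_def good_level_def)
  ultimately show thesis using that[of S T] tracks_visit[OF V(1,2)] by simp
qed

text \<open>Rotate \<open>u\<close> to start right after a letter whose loop comprises all states on
  \<open>u\<close>. There the memory repeats after a single round, so all positive powers of
  \<open>u\<close> act on \<open>\<sigma>\<close> like \<open>u\<close>.\<close>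

lemma foldl_step_aperiodic:
  assumes good_memory: "good_memory \<sigma>" and "u \<noteq> []" and n: "n > 0"
    and cyc: "foldl step \<sigma> (concat (replicate n u)) = \<sigma>"
    and p_cyc: "foldl f (fst \<sigma>) u = fst \<sigma>"
  shows "foldl step \<sigma> u = \<sigma>"
proof -
  obtain p D st q where \<sigma>: "\<sigma> = (p, D, st, q)" by (cases \<sigma>)
  define ps where "ps = path f p u"
  have pu: "foldl f p u = p" using p_cyc \<sigma> by simp
  obtain m where m: "n = Suc m" using n by (cases n) auto
  have "D = foldl visit D (concat (replicate n ps))"
    using foldl_step_record[of \<sigma> "concat (replicate n u)"] cyc \<sigma> path_power[OF pu] ps_def by simp
  also have "\<dots> = foldl visit (foldl visit D (concat (replicate m ps))) ps"
    unfolding m by (metis replicate_append_same concat_append concat.simps append_Nil2 foldl_append replicate_Suc)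
  finally have D_eq: "D = foldl visit (foldl visit D (concat (replicate m ps))) ps" .
  \<comment> \<open>The record results from a complete round, so a further round does not change
    it.\<close>
  then have D_ps: "foldl visit D ps = D" by (metis foldl_visit_idem)
  have tr: "tracks (set ps) D" using D_eq tracks_foldl_visit by metis
  have "ps \<noteq> []" using \<open>u \<noteq> []\<close> ps_def by (metis length_path length_0_conv)
  obtain ps1 s ps2 where s: "ps = ps1 @ s # ps2" "foldl visit D ps1 s = set ps"
    using tracks_full_hit[OF tr \<open>ps \<noteq> []\<close>] .
  obtain u1 x u2 where u: "u = u1 @ x # u2" "path f p u1 = ps1" "f (foldl f p u1) x = s"
    using path_split[of f p u ps1 s ps2] s ps_def by metis
  obtain p1 D1 st1 q1 where \<sigma>1: "foldl step \<sigma> u1 = (p1, D1, st1, q1)" by (cases "foldl step \<sigma> u1")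
  have p1: "p1 = foldl f p u1" using foldl_step_fst[of \<sigma> u1] \<sigma>1 \<sigma> by simp
  have D1: "D1 = foldl visit D ps1" using foldl_step_record[of \<sigma> u1] \<sigma>1 \<sigma> u by simp
  have "tracks (set ps) (foldl visit D qs)" if "set qs \<subseteq> set ps" for qs
    using that by (induction qs rule: rev_induct) (auto simp: tr tracks_visit)
  then have tr1: "tracks (set ps) D1" using D1 s by auto
  have V1: "f p1 x \<in> set ps" "D1 (f p1 x) = set ps" using p1 D1 u s by auto
  have gm1: "good_memory (p1, D1, st1, q1)" using good_memory_foldl_step[OF good_memory, of u1] \<sigma>1 by simp
  define \<tau> where "\<tau> = step (p1, D1, st1, q1) x"
  obtain S T where ST: "\<tau> = (f p1 x, visit D1 (f p1 x), (set ps, S) # T, base S)"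
    "anchored (set ps) S T \<tau>"
    unfolding \<tau>_def using anchored_start[OF gm1 tr1 V1] .
  have p\<tau>: "fst \<tau> = foldl f p (u1 @ [x])" using ST p1 by simp
  have pu2: "foldl f (fst \<tau>) u2 = p" using p\<tau> pu u by simp
  have gm\<tau>: "good_memory \<tau>" using gm1 good_memory_step \<tau>_def by blast
  let ?\<rho> = "foldl step \<tau> (u2 @ u1)"
  obtain p2 D2 st2 q2 where \<rho>: "?\<rho> = (p2, D2, st2, q2)" by (cases ?\<rho>)
  have "path f p u = path f p (u1 @ [x]) @ path f (fst \<tau>) u2"
    using u(1) p\<tau> path_append[of f p "u1 @ [x]" u2] by simp
  then have "set (path f (fst \<tau>) (u2 @ u1)) \<subseteq> set ps"
    using pu2 u s ps_def by (auto simp: path_append)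
  then have "anchored (set ps) S T ?\<rho>" using anchored_foldl_step gm\<tau> ST by blast
  moreover have "p2 = p1" using foldl_step_fst[of \<tau> "u2 @ u1"] \<rho> pu2 p1 by simp
  moreover have "D2 = D1"
  proof -
    have \<tau>_eq: "\<tau> = foldl step \<sigma> (u1 @ [x])" using \<sigma>1 \<tau>_def by simp
    have "?\<rho> = foldl step \<sigma> (u @ u1)" unfolding \<tau>_eq u(1) by simp
    then have "D2 = foldl visit D (path f p (u @ u1))"
      using foldl_step_record[of \<sigma> "u @ u1"] \<rho> \<sigma> by simp
    then show ?thesis using D_ps D1 pu u(2) ps_def by (simp add: path_append)
  qed
  moreover have "good_memory ?\<rho>" using good_memory_foldl_step gm\<tau> by blast
  \<comment> \<open>Before \<open>x\<close> the input state and the record are as one round earlier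
    and the level is still anchored, so the full loop restores \<open>\<tau>\<close>.\<close>
  ultimately have "step ?\<rho> x = \<tau>"
    using anchored_step(3)[of p2 D2 st2 q2 "set ps" S T x] \<rho> V1 ST by simp
  then have \<tau>_cyc: "foldl step \<tau> (u2 @ u1 @ [x]) = \<tau>" by simp
  have one: "foldl step \<sigma> u = foldl step \<tau> u2" unfolding u(1) using \<sigma>1 \<tau>_def by simp
  have two: "foldl step (foldl step \<tau> u2) u = foldl step \<tau> u2"
    unfolding u(1) using \<tau>_cyc by simp
  have "foldl step (foldl step \<tau> u2) (concat (replicate k u)) = foldl step \<tau> u2" for k
    by (induction k) (auto simp: two)
  then have "foldl step \<sigma> (concat (replicate n u)) = foldl step \<sigma> u" unfolding m using one by simp
  then show ?thesis using cyc by simp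
qed

text \<open>The start state counts as visited.\<close>

definition init :: "('p, 'q) memory" where
  "init = (p0, visit (\<lambda>_. {}) p0, [], q0)"

lemma good_memory_init: "good_memory init"
  using p0 q0 start
  by (auto simp: init_def good_stack_def good_record_def visit_def intro!: exI[of _ "[]"] split: if_splits)

text \<open>A good record is empty outside \<open>P\<close> and has subsets of \<open>P\<close> as
  values; a good stack is a distinct list over a finite set.\<close>

lemma finite_good_memory: "finite {\<sigma>. good_memory \<sigma>}"
proof (rule finite_subset)
  let ?Ds = "{D. \<forall>s. (s \<in> P \<longrightarrow> D s \<in> Pow P) \<and> (s \<notin> P \<longrightarrow> D s = {})}"
  let ?Ss = "{st. set st \<subseteq> Pow P \<times> Pow Q \<and> distinct st}"
  show "finite (P \<times> ?Ds \<times> ?Ss \<times> Q)"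
    by (intro finite_cartesian_product finite_subset_distinct finite_set_of_finite_funs)
      (auto simp: finite_P finite_Q)
  have Ds: "D \<in> ?Ds" if "good_record p D" for p D
    using that unfolding good_record_def by blast
  have Ss: "st \<in> ?Ss" if st: "good_stack p q st" for p q st
  proof -
    have "sorted_wrt (\<lambda>y z. fst y \<subset> fst z \<and> snd y \<subseteq> snd z) st"
      using st unfolding good_stack_def by blast
    then have "distinct st" by (induction st) auto
    moreover have "y \<in> Pow P \<times> Pow Q" if "y \<in> set st" for y
      using st that unfolding good_stack_def good_level_def mem_Times_iff by blast
    ultimately show ?thesis by blast
  qed
  show "{\<sigma>. good_memory \<sigma>} \<subseteq> P \<times> ?Ds \<times> ?Ss \<times> Q"
  proof
    fix \<sigma> assume "\<sigma> \<in> {\<sigma>. good_memory \<sigma>}"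
    moreover obtain p D st q where \<sigma>: "\<sigma> = (p, D, st, q)" by (cases \<sigma>)
    ultimately have "good_stack p q st" "good_record p D" by auto
    moreover from this(1) have "p \<in> P" "q \<in> Q" unfolding good_stack_def by auto
    ultimately show "\<sigma> \<in> P \<times> ?Ds \<times> ?Ss \<times> Q"
      unfolding \<sigma> by (intro SigmaI Ds Ss)
  qed
qed

end

section \<open>Infinite words assembled from output blocks\<close>

lemma ex_word_of_blocks:
  fixes w :: "nat \<Rightarrow> 'a list"
  assumes "\<And>N. \<exists>n\<ge>N. w n \<noteq> []"
  shows "\<exists>\<zeta>. (\<forall>n. prefix (length (concat (map w [0..<n]))) \<zeta> = concat (map w [0..<n])) \<and>
    (\<forall>m. \<exists>n. m < length (concat (map w [0..<n])))"
proof -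
  define W where "W n = concat (map w [0..<n])" for n
  have W_Suc: "W (Suc n) = W n @ w n" for n by (simp add: W_def)
  have mono: "\<exists>v. W n = W m @ v" if "m \<le> n" for m n
    using that by (induction n rule: dec_induct) (auto simp: W_Suc)
  have unb: "\<exists>n. m < length (W n)" for m
  proof (induction m)
    case 0
    obtain n where "w n \<noteq> []" using assms by blast
    then show ?case by (intro exI[of _ "Suc n"]) (simp add: W_Suc)
  next
    case (Suc m)
    then obtain n where n: "m < length (W n)" by blast
    obtain k where k: "k \<ge> n" "w k \<noteq> []" using assms by blast
    obtain v where "W k = W n @ v" using mono[OF k(1)] by blast
    then show ?case using n k by (intro exI[of _ "Suc k"]) (cases "w k"; simp add: W_Suc)
  qed
  \<comment> \<open>Later prefixes extend earlier ones, so the first one that is long enough decides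
    the letter at \<open>i\<close>.\<close>
  define \<zeta> where "\<zeta> i = W (LEAST n. i < length (W n)) ! i" for i
  have "\<zeta> i = W n ! i" if i: "i < length (W n)" for i n
  proof -
    let ?k = "LEAST n. i < length (W n)"
    have "?k \<le> n" "i < length (W ?k)" using i by (auto intro: Least_le LeastI)
    then show ?thesis using mono[of ?k n] unfolding \<zeta>_def by (auto simp: nth_append)
  qed
  then have "prefix (length (W n)) \<zeta> = W n" for n by (intro nth_equalityI) auto
  then show ?thesis using unb unfolding W_def by blast
qed

lemma limit_trail_blocks:
  fixes w :: "nat \<Rightarrow> 'a list"
  assumes W: "\<And>n. prefix (length (concat (map w [0..<n]))) \<zeta> = concat (map w [0..<n])"
    and unb: "\<And>m. \<exists>n. m < length (concat (map w [0..<n]))"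
    and q: "\<And>n. q (Suc n) = foldl g (q n) (w n)"
    and sub: "\<And>n. n \<ge> N \<Longrightarrow> visited g (q n) (w n) \<subseteq> S"
    and sup: "\<And>m. \<exists>n\<ge>m. S \<subseteq> visited g (q n) (w n)"
  shows "limit (trail g (q 0) \<zeta>) = S"
proof -
  define l where "l n = length (concat (map w [0..<n]))" for n
  let ?t = "trail g (q 0) \<zeta>"
  have l_Suc: "l (Suc n) = l n + length (w n)" for n by (simp add: l_def)
  have l_mono: "l m \<le> l n" if "m \<le> n" for m n
    using that by (induction n rule: dec_induct) (auto simp: l_Suc)
  have t: "?t (l n) = q n" for n
  proof -
    have "foldl g (q 0) (concat (map w [0..<n])) = q n" by (induction n) (auto simp: q)
    then show ?thesis using W[of n] unfolding trail_def l_def by simp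
  qed
  have "\<zeta> [l n \<rightarrow> l (Suc n)] = w n" for n
  proof -
    have "prefix (l n) \<zeta> @ \<zeta> [l n \<rightarrow> l (Suc n)] = prefix (l n) \<zeta> @ w n"
      using W[of n] W[of "Suc n"] subsequence_append[where i = "l n" and j = "length (w n)" and w = \<zeta>]
      unfolding l_Suc by (simp add: l_def)
    then show ?thesis by simp
  qed
  then have vis: "visited g (q n) (w n) = ?t ` {l n..l (Suc n)}" for n
    using visited_subsequence_trail[OF l_mono[of n "Suc n"], of g "q 0" \<zeta>] t by simp
  have "t \<in> S" if t: "t \<in> limit ?t" for t
  proof -
    obtain i where i: "i \<ge> l N" "?t i = t" using t by (auto simp: limit_iff_frequent INFM_nat_le)
    obtain k where k: "i < l k" using unb[of i] l_def by auto
    \<comment> \<open>The block containing position \<open>i\<close>; its index is at least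
      \<open>N\<close> because \<open>i\<close> lies beyond the first \<open>N\<close>
      blocks.\<close>
    have "\<exists>n\<ge>N. l n \<le> i \<and> i \<le> l (Suc n)"
    proof -
      let ?k = "LEAST k. i < l k"
      have k: "i < l ?k" using k by (rule LeastI)
      have "\<not> ?k \<le> N" using l_mono[of ?k N] k i by auto
      then obtain n where n: "?k = Suc n" "N \<le> n" by (cases ?k) auto
      then have "\<not> i < l n" using not_less_Least[of n "\<lambda>k. i < l k"] by simp
      then show ?thesis using n k by (intro exI[of _ n]) auto
    qed
    then obtain n where "n \<ge> N" "i \<in> {l n..l (Suc n)}" by auto
    then show ?thesis using sub[of n] vis[of n] i by auto
  qed
  moreover have "s \<in> limit ?t" if "s \<in> S" for s
  proof -
    have "\<exists>i\<ge>m. ?t i = s" for m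
    proof -
      obtain k where k: "m < l k" using unb[of m] l_def by auto
      obtain n where n: "n \<ge> k" "S \<subseteq> visited g (q n) (w n)" using sup by blast
      then have "s \<in> ?t ` {l n..l (Suc n)}" using that vis[of n] by blast
      then obtain i where "i \<ge> l n" "?t i = s" by auto
      then show ?thesis using k l_mono[OF n(1)] by (intro exI[of _ i]) auto
    qed
    then show ?thesis by (simp add: limit_iff_frequent INFM_nat_le)
  qed
  ultimately show ?thesis by blast
qed

context reducible_pair
begin

text \<open>Once the input run stays in its limit set \<open>L\<close> and has passed through it, a
  full loop anchors a level \<open>(L, S)\<close>; from then on every output block stays inside
  \<open>S\<close>, and infinitely many cover it.\<close>

lemma transducer_output:
  "\<exists>\<zeta>. (\<forall>n. prefix (length (concat (map (\<lambda>j. out (trail step init \<xi> j) (\<xi> j)) [0..<n]))) \<zeta> =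
      concat (map (\<lambda>j. out (trail step init \<xi> j) (\<xi> j)) [0..<n])) \<and>
    (\<forall>m. \<exists>n. m < length (concat (map (\<lambda>j. out (trail step init \<xi> j) (\<xi> j)) [0..<n]))) \<and>
    a (limit (trail f p0 \<xi>)) = b (limit (trail g q0 \<zeta>))"
proof -
  define \<sigma> where "\<sigma> = trail step init \<xi>"
  define r where "r = trail f p0 \<xi>"
  define w where "w j = out (\<sigma> j) (\<xi> j)" for j
  define D where "D n = fst (snd (\<sigma> n))" for n
  define st where "st n = fst (snd (snd (\<sigma> n)))" for n
  define q where "q n = snd (snd (snd (\<sigma> n)))" for n
  have good_memory: "good_memory (\<sigma> n)" for n
    unfolding \<sigma>_def trail_def by (intro good_memory_foldl_step good_memory_init)
  have \<sigma>: "\<sigma> n = (r n, D n, st n, q n)" for n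
    using foldl_step_fst[of init "prefix n \<xi>"]
    by (intro prod_eqI) (simp_all add: D_def st_def q_def r_def \<sigma>_def trail_def init_def)
  have \<sigma>_Suc: "\<sigma> (Suc n) = step (\<sigma> n) (\<xi> n)" for n by (simp add: \<sigma>_def trail_Suc)
  have r_Suc: "r (Suc n) = f (r n) (\<xi> n)" for n by (simp add: r_def trail_Suc)
  have q_Suc: "q (Suc n) = foldl g (q n) (w n)" for n
    using foldl_out_step[OF good_memory[of n]] by (simp add: q_def w_def \<sigma>_Suc)
  have D_range: "D n = foldl visit (D m) (map r [Suc m..<Suc n])" if "m \<le> n" for m n
  proof -
    have "\<sigma> n = foldl step (\<sigma> m) (\<xi> [m \<rightarrow> n])"
      unfolding \<sigma>_def foldl_subsequence_trail[OF that] ..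
    then have "D n = foldl visit (D m) (path f (fst (\<sigma> m)) (\<xi> [m \<rightarrow> n]))"
      unfolding D_def using foldl_step_record by metis
    moreover have "fst (\<sigma> m) = r m" by (simp add: \<sigma>[of m])
    ultimately show ?thesis unfolding r_def using path_subsequence[OF that, of f p0 \<xi>] by simp
  qed
  have "r n \<in> P" for n using good_memory[of n] \<sigma>[of n] by (simp add: good_stack_def)
  then have fin_r: "finite (range r)" using finite_P by (meson finite_subset image_subsetI)
  then obtain N0 where N0: "limit r = range (suffix N0 r)" using limit_is_suffix by blast
  define L where "L = limit r"
  have r_L: "r n \<in> L" if "n \<ge> N0" for n
  proof -
    have "r n = suffix N0 r (n - N0)" using that by simp
    then show ?thesis unfolding L_def N0 by blast
  qed
  have "finite L" using fin_r limit_in_range[of r] finite_subset L_def by blast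
  have "L \<noteq> {}" using r_L by blast
  have full: "\<exists>n\<ge>m. set (map r [Suc m..<Suc n]) = L" if m: "m \<ge> N0" for m
  proof -
    have "\<exists>i>m. r i = s" if "s \<in> L" for s
      using that unfolding L_def limit_iff_frequent INFM_nat by blast
    then obtain i where i: "\<And>s. s \<in> L \<Longrightarrow> i s > m \<and> r (i s) = s" by metis
    define n where "n = max m (Max (i ` L))"
    have "s \<in> set (map r [Suc m..<Suc n])" if "s \<in> L" for s
    proof -
      have "i s \<le> n" using \<open>finite L\<close> that unfolding n_def by (intro max.coboundedI2 Max_ge) auto
      then show ?thesis using i[OF that] by (auto simp del: upt_Suc intro!: image_eqI[of _ _ "i s"])
    qed
    moreover have "set (map r [Suc m..<Suc n]) \<subseteq> L" using r_L m by auto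
    ultimately show ?thesis using n_def by (intro exI[of _ n]) auto
  qed
  \<comment> \<open>By \<open>N1\<close> every state of \<open>L\<close> has been visited after the
    run settled in \<open>L\<close>, so no record of such a state reaches outside
    \<open>L\<close>.\<close>
  obtain N1 where N1: "N1 \<ge> N0" "set (map r [Suc N0..<Suc N1]) = L" using full by blast
  have tr: "tracks L (D n)" if "n \<ge> N1" for n
    using that
  proof (induction n rule: dec_induct)
    case base
    show ?case using D_range[OF N1(1)] tracks_foldl_visit N1(2) by metis
  next
    case (step n)
    have "D (Suc n) = visit (D n) (r (Suc n))" using D_range[of n "Suc n"] by simp
    then show ?case using step r_L[of "Suc n"] N1 by (simp add: tracks_visit)
  qed
  \<comment> \<open>Every window passing through all of \<open>L\<close> contains a full loop by
    \<open>tracks_full_hit\<close>, so full loops recur forever.\<close>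
  have hit: "\<exists>n\<ge>m. D n (r (Suc n)) = L" if m: "m \<ge> N1" for m
  proof -
    obtain n where n: "n \<ge> m" "set (map r [Suc m..<Suc n]) = L" using full[of m] m N1 by auto
    have "map r [Suc m..<Suc n] \<noteq> []" using n \<open>L \<noteq> {}\<close> by (metis list.set(1))
    then obtain ps1 s ps2 where s: "map r [Suc m..<Suc n] = ps1 @ s # ps2" "foldl visit (D m) ps1 s = L"
      using tracks_full_hit tr[OF m] n(2) by metis
    define k where "k = m + length ps1"
    have len: "length ps1 < n - m" using arg_cong[OF s(1), of length] by (simp del: upt_Suc)
    then have "k < n" unfolding k_def by simp
    then have "[Suc m..<Suc n] = [Suc m..<Suc k] @ Suc k # [Suc (Suc k)..<Suc n]"
      using upt_add_eq_append[of "Suc m" "Suc k" "n - k"] upt_conv_Cons[of "Suc k" "Suc n"] k_def by simp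
    then have "map r [Suc m..<Suc k] @ r (Suc k) # map r [Suc (Suc k)..<Suc n] = ps1 @ s # ps2"
      using s(1) by simp
    moreover have "length (map r [Suc m..<Suc k]) = length ps1" by (simp add: k_def del: upt_Suc)
    ultimately have "map r [Suc m..<Suc k] = ps1" "r (Suc k) = s"
      by (simp_all add: append_eq_append_conv del: length_map length_upt)
    then have "D k (r (Suc k)) = L" using D_range[of m k] s(2) k_def by simp
    then show ?thesis using k_def by (intro exI[of _ k]) simp
  qed
  obtain N2 where N2: "N2 \<ge> N1" "D N2 (r (Suc N2)) = L" using hit by blast
  have rL': "f (r n) (\<xi> n) \<in> L" if "n \<ge> N2" for n
    using r_L[of "Suc n"] that N1 N2 r_Suc by simp
  have hit0: "D N2 (f (r N2) (\<xi> N2)) = L" using N2(2) r_Suc by simp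
  have \<sigma>_N2: "\<sigma> (Suc N2) = step (r N2, D N2, st N2, q N2) (\<xi> N2)"
    using \<sigma>_Suc[of N2] unfolding \<sigma>[of N2] .
  \<comment> \<open>The full loop at \<open>N2\<close> creates the level that persists and fixes its
    colour.\<close>
  obtain S T where anch0: "anchored L S T (\<sigma> (Suc N2))" and col: "a L = b S"
    unfolding \<sigma>_N2
    using anchored_start[OF good_memory[of N2, unfolded \<sigma>] tr[OF N2(1)] rL'[OF order_refl] hit0] by blast
  have anch: "anchored L S T (\<sigma> n)" if "n \<ge> Suc N2" for n
    using that
  proof (induction n rule: dec_induct)
    case (step n)
    have "anchored L S T (step (r n, D n, st n, q n) (\<xi> n))"
      by (rule anchored_step(1)) (use step good_memory[of n] \<sigma>[of n] rL'[of n] in auto)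
    then show ?case using \<sigma> \<sigma>_Suc by metis
  qed (fact anch0)
  have sub: "visited g (q n) (w n) \<subseteq> S" if n: "n \<ge> Suc N2" for n
  proof -
    have "visited g (q n) (out (r n, D n, st n, q n) (\<xi> n)) \<subseteq> S"
      by (rule anchored_step(2)[of _ _ _ _ L _ T]) (use anch[OF n] good_memory[of n] \<sigma>[of n] rL'[of n] n in auto)
    then show ?thesis using w_def \<sigma> by metis
  qed
  have sup: "\<exists>n\<ge>m. S \<subseteq> visited g (q n) (w n) \<and> w n \<noteq> []" for m
  proof -
    have "N1 \<le> max m (Suc N2)" using N2(1) by simp
    then obtain n where n: "n \<ge> max m (Suc N2)" "D n (r (Suc n)) = L" using hit by blast
    have "S \<subseteq> visited g (q n) (out (r n, D n, st n, q n) (\<xi> n)) \<and> out (r n, D n, st n, q n) (\<xi> n) \<noteq> []"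
      using anchored_step(3)[of "r n" "D n" "st n" "q n" L S T "\<xi> n"] anch[of n] good_memory[of n] \<sigma>[of n] rL'[of n] n
        r_Suc[of n] by simp
    then show ?thesis using n(1) w_def \<sigma> by (intro exI[of _ n]) auto
  qed
  obtain \<zeta> where \<zeta>: "\<And>n. prefix (length (concat (map w [0..<n]))) \<zeta> = concat (map w [0..<n])"
    "\<And>m. \<exists>n. m < length (concat (map w [0..<n]))"
    using ex_word_of_blocks[of w] sup by metis
  have "limit (trail g (q 0) \<zeta>) = S"
    using limit_trail_blocks[OF \<zeta> q_Suc sub] sup by metis
  moreover have "q 0 = q0" by (simp add: q_def \<sigma>_def init_def)
  ultimately have "a (limit (trail f p0 \<xi>)) = b (limit (trail g q0 \<zeta>))"
    using col by (simp add: L_def r_def)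
  then show ?thesis
    using \<zeta> unfolding w_def \<sigma>_def by (intro exI[of _ \<zeta>] conjI allI)
qed

text \<open>States of an \<open>automaton\<close> are natural numbers, so the finitely many good
  memories are coded by an injection \<open>e\<close>. Aperiodicity is concluded as an implication
  so that one construction serves both halves of the theorem.\<close>

lemma ex_transducer:
  obtains M F m G h where "automaton M F m" "computes F G m h"
    "\<forall>\<xi>. a (limit (trail f p0 \<xi>)) = b (limit (trail g q0 (h \<xi>)))"
    "(\<forall>p\<in>P. \<forall>u n. u \<noteq> [] \<and> n > 0 \<and> foldl f p (concat (replicate n u)) = p \<longrightarrow> foldl f p u = p)
      \<longrightarrow> aperiodic_aut M F"
proof -
  obtain e :: "('p, 'q) memory \<Rightarrow> nat" where e: "inj_on e {\<sigma>. good_memory \<sigma>}"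
    using finite_imp_inj_to_nat_seg[OF finite_good_memory] by metis
  define M where "M = e ` {\<sigma>. good_memory \<sigma>}"
  define d where "d = inv_into {\<sigma>. good_memory \<sigma>} e"
  have d: "d (e \<sigma>) = \<sigma>" if "good_memory \<sigma>" for \<sigma> using e that by (simp add: d_def)
  define F where "F n x = e (step (d n) x)" for n x
  define G where "G n x = out (d n) x" for n x
  have F_e: "foldl F (e \<sigma>) w = e (foldl step \<sigma> w)" if "good_memory \<sigma>" for \<sigma> w
    using that by (induction w arbitrary: \<sigma>) (auto simp: F_def d good_memory_step simp del: step.simps good_memory.simps)
  have run_e: "run F (e init) \<xi> j = e (trail step init \<xi> j)" for \<xi> j
    using F_e[OF good_memory_init] by (simp add: run_def ftrans_def trail_def subsequence_def)
  have good_memory_tr: "good_memory (trail step init \<xi> j)" for \<xi> j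
    unfolding trail_def by (intro good_memory_foldl_step good_memory_init)
  have out_e: "out_prefix F G (e init) \<xi> n = concat (map (\<lambda>j. out (trail step init \<xi> j) (\<xi> j)) [0..<n])" for \<xi> n
    unfolding out_prefix_def run_e G_def d[OF good_memory_tr] ..
  have aut: "automaton M F (e init)"
    unfolding automaton_def
  proof (intro conjI ballI allI)
    show "finite M" using finite_good_memory M_def by blast
    show "e init \<in> M" using good_memory_init M_def by blast
    fix n x assume "n \<in> M"
    then obtain \<sigma> where \<sigma>: "n = e \<sigma>" "good_memory \<sigma>" unfolding M_def by blast
    have "F n x = e (step \<sigma> x)" unfolding F_def \<sigma>(1) d[OF \<sigma>(2)] ..
    moreover have "good_memory (step \<sigma> x)" using good_memory_step[OF \<sigma>(2)] .
    ultimately show "F n x \<in> M" unfolding M_def by simp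
  qed
  have "\<forall>\<xi>. \<exists>\<zeta>. (\<forall>n. prefix (length (out_prefix F G (e init) \<xi> n)) \<zeta> = out_prefix F G (e init) \<xi> n) \<and>
      (\<forall>m. \<exists>n. m < length (out_prefix F G (e init) \<xi> n)) \<and>
      a (limit (trail f p0 \<xi>)) = b (limit (trail g q0 \<zeta>))"
    unfolding out_e using transducer_output by (rule allI)
  from choice[OF this]
  obtain h where h: "\<And>\<xi> n. prefix (length (out_prefix F G (e init) \<xi> n)) (h \<xi>) = out_prefix F G (e init) \<xi> n"
    "\<And>\<xi> m. \<exists>n. m < length (out_prefix F G (e init) \<xi> n)"
    "\<And>\<xi>. a (limit (trail f p0 \<xi>)) = b (limit (trail g q0 (h \<xi>)))"
    by blast
  have comp: "computes F G (e init) h"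
    unfolding computes_def
  proof (intro allI conjI impI)
    fix \<xi> m
    show "\<exists>n. m < length (out_prefix F G (e init) \<xi> n)" by (fact h(2))
  next
    fix \<xi> n i assume i: "i < length (out_prefix F G (e init) \<xi> n)"
    have "h \<xi> i = prefix (length (out_prefix F G (e init) \<xi> n)) (h \<xi>) ! i" using i by simp
    then show "h \<xi> i = out_prefix F G (e init) \<xi> n ! i" unfolding h(1) .
  qed
  have "aperiodic_aut M F"
    if ap: "\<forall>p\<in>P. \<forall>u n. u \<noteq> [] \<and> n > 0 \<and> foldl f p (concat (replicate n u)) = p \<longrightarrow> foldl f p u = p"
    unfolding aperiodic_aut_def
  proof (intro ballI allI impI)
    fix k u n assume "k \<in> M" and u: "u \<noteq> [] \<and> n > 0 \<and> ftrans F k (concat (replicate n u)) = k"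
    then obtain \<sigma> where \<sigma>: "k = e \<sigma>" "good_memory \<sigma>" unfolding M_def by blast
    have "e (foldl step \<sigma> (concat (replicate n u))) = e \<sigma>" using u F_e \<sigma> by (simp add: ftrans_def)
    then have cyc: "foldl step \<sigma> (concat (replicate n u)) = \<sigma>"
      using e good_memory_foldl_step[OF \<sigma>(2)] \<sigma>(2) by (metis inj_on_contraD mem_Collect_eq)
    have "foldl f (fst \<sigma>) (concat (replicate n u)) = fst \<sigma>" using foldl_step_fst cyc by metis
    moreover have "fst \<sigma> \<in> P" using \<sigma>(2) by (cases \<sigma>) (simp add: good_stack_def)
    ultimately have "foldl f (fst \<sigma>) u = fst \<sigma>" using ap u by blast
    then have "foldl step \<sigma> u = \<sigma>" using foldl_step_aperiodic \<sigma>(2) cyc u by blast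
    then show "ftrans F k u = k" using F_e \<sigma> by (simp add: ftrans_def)
  qed
  then show thesis using that[OF aut comp] h(3) by blast
qed

end

section \<open>Partitions and product automata\<close>

text \<open>With a finite range, \<open>w\<close> eventually takes only values from its limit
  set.\<close>

lemma limit_image:
  assumes "finite (range w)"
  shows "limit (f \<circ> w) = f ` limit w"
proof
  obtain k where k: "limit w = range (suffix k w)" using limit_is_suffix[OF assms] by blast
  have "limit (f \<circ> w) \<subseteq> range (suffix k (f \<circ> w))" by (rule limit_in_range_suffix)
  then show "limit (f \<circ> w) \<subseteq> f ` limit w" unfolding k by auto
qed (auto simp: limit_o)

text \<open>Fixing the coordinates from \<open>k\<close> on to 0 keeps the set of product states
  finite.\<close>

definition product_step :: "nat \<Rightarrow> (nat \<Rightarrow> nat \<Rightarrow> 'a \<Rightarrow> nat) \<Rightarrow> (nat \<Rightarrow> nat) \<Rightarrow> 'a \<Rightarrow> nat \<Rightarrow> nat" where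
  "product_step k f q x = (\<lambda>i. if i < k then f i (q i) x else 0)"

lemma foldl_product_step: "i < k \<Longrightarrow> foldl (product_step k f) q w i = foldl (f i) (q i) w"
  by (induction w arbitrary: q) (auto simp: product_step_def)

text \<open>The limit set of the product run projects to the limit set of each component run, hence
  determines the value of \<open>A\<close>.\<close>

lemma partition_automaton:
  fixes A :: "'a oword \<Rightarrow> nat"
  assumes A: "kpartition k A"
    and aut: "\<And>i. i < k \<Longrightarrow> automaton (Q i) (f i) (q i) \<and> {\<xi>. A \<xi> = i} = {\<xi>. inf_states (f i) (q i) \<xi> \<in> \<F> i}"
  obtains P p0 c where "finite P" "p0 \<in> P" "\<forall>p\<in>P. \<forall>x. product_step k f p x \<in> P"
    "\<forall>p\<in>P. \<forall>i<k. p i \<in> Q i" "\<forall>p\<in>P. \<forall>i\<ge>k. p i = 0"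
    "\<forall>\<xi>. A \<xi> = c (limit (trail (product_step k f) p0 \<xi>))"
proof -
  define P where "P = {p. (\<forall>i<k. p i \<in> Q i) \<and> (\<forall>i\<ge>k. p i = (0::nat))}"
  define p0 where "p0 i = (if i < k then q i else 0)" for i
  \<comment> \<open>For the limit set of a run from \<open>p0\<close> exactly one index qualifies,
    because the components partition the space; on other sets the value does not matter.\<close>
  define c where "c X = (THE i. i < k \<and> (\<lambda>p. p i) ` X \<in> \<F> i)" for X
  let ?f = "product_step k f"
  have "finite P"
  proof (rule finite_subset)
    show "P \<subseteq> {p. \<forall>i. (i \<in> {..<k} \<longrightarrow> p i \<in> (\<Union>i<k. Q i)) \<and> (i \<notin> {..<k} \<longrightarrow> p i = 0)}"
      by (auto simp: P_def)
    show "finite {p. \<forall>i. (i \<in> {..<k} \<longrightarrow> p i \<in> (\<Union>i<k. Q i)) \<and> (i \<notin> {..<k} \<longrightarrow> p i = (0::nat))}"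
      by (rule finite_set_of_finite_funs) (use aut in \<open>auto simp: automaton_def\<close>)
  qed
  have p0: "p0 \<in> P" using aut by (auto simp: P_def p0_def automaton_def)
  have closed: "?f p x \<in> P" if "p \<in> P" for p x
    using that aut by (auto simp: P_def product_step_def automaton_def)
  have trail_P: "trail ?f p0 \<xi> n \<in> P" for \<xi> n
    by (induction n) (auto simp: p0 closed trail_Suc)
  have "A \<xi> = c (limit (trail ?f p0 \<xi>))" for \<xi>
  proof -
    let ?X = "limit (trail ?f p0 \<xi>)"
    have "inf_states (f i) (q i) \<xi> = (\<lambda>p. p i) ` ?X" if i: "i < k" for i
    proof -
      have "(\<lambda>p. p i) \<circ> trail ?f p0 \<xi> = run (f i) (q i) \<xi>"
        using i by (auto simp: trail_def run_def ftrans_def foldl_product_step p0_def subsequence_def)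
      moreover have "finite (range (trail ?f p0 \<xi>))"
        using \<open>finite P\<close> trail_P by (meson finite_subset image_subsetI)
      ultimately have "limit (run (f i) (q i) \<xi>) = (\<lambda>p. p i) ` ?X"
        using limit_image[of "trail ?f p0 \<xi>" "\<lambda>p. p i"] by simp
      then show ?thesis
        by (auto simp: inf_states_def limit_def Inf_many_def)
    qed
    then have "A \<xi> = i \<longleftrightarrow> (\<lambda>p. p i) ` ?X \<in> \<F> i" if "i < k" for i
      using aut[OF that] that by (metis (mono_tags) mem_Collect_eq)
    moreover have "A \<xi> < k" using A by (simp add: kpartition_def)
    ultimately show ?thesis unfolding c_def by (intro the_equality[symmetric]) auto
  qed
  then have "\<forall>\<xi>. A \<xi> = c (limit (trail ?f p0 \<xi>))" by blast
  moreover have "\<forall>p\<in>P. \<forall>x. ?f p x \<in> P" using closed by blast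
  moreover have "\<forall>p\<in>P. \<forall>i<k. p i \<in> Q i" "\<forall>p\<in>P. \<forall>i\<ge>k. p i = 0" by (simp_all add: P_def)
  ultimately show thesis by (intro that[OF \<open>finite P\<close> p0])
qed

text \<open>The first \<open>m\<close> input letters determine the first \<open>m\<close> output
  blocks, which together already exceed \<open>n\<close> letters.\<close>

lemma computes_continuous:
  assumes "computes f g q0 h"
  shows "cantor_continuous h"
  unfolding cantor_continuous_def
proof (intro allI)
  fix \<xi> :: "'a oword" and n
  have *: "i < length (out_prefix f g q0 \<xi> m) \<Longrightarrow> h \<xi> i = out_prefix f g q0 \<xi> m ! i" for \<xi> m i
    using assms unfolding computes_def by blast
  obtain m where m: "n < length (out_prefix f g q0 \<xi> m)"
    using assms unfolding computes_def by blast
  have "h \<eta> i = h \<xi> i" if "\<forall>i<m. \<eta> i = \<xi> i" "i < n" for \<eta> i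
  proof -
    have "run f q0 \<eta> j = run f q0 \<xi> j" if "j < m" for j
      unfolding run_def using \<open>\<forall>i<m. \<eta> i = \<xi> i\<close> that by (intro arg_cong[of _ _ "ftrans f q0"]) auto
    then have "out_prefix f g q0 \<eta> m = out_prefix f g q0 \<xi> m"
      unfolding out_prefix_def using that(1) by (intro arg_cong[of _ _ concat]) auto
    then show ?thesis using * m that(2) by (metis less_trans)
  qed
  then show "\<exists>m. \<forall>\<eta>. (\<forall>i<m. \<eta> i = \<xi> i) \<longrightarrow> (\<forall>i<n. h \<eta> i = h \<xi> i)" by blast
qed

text \<open>The automata for \<open>A\<close> are parameters so that the last conclusion can refer
  to them; their product inherits aperiodicity coordinatewise.\<close>

lemma ex_computed_reduction:
  fixes A B :: "'a oword \<Rightarrow> nat"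
  assumes A: "kpartition k A" and B: "kpartition k B"
    and autA: "\<And>i. i < k \<Longrightarrow> automaton (QA i) (fA i) (qA i) \<and> {\<xi>. A \<xi> = i} = {\<xi>. inf_states (fA i) (qA i) \<xi> \<in> FA i}"
    and B_reg: "\<And>i. i < k \<Longrightarrow> regular_lang {\<xi>. B \<xi> = i}"
    and le: "le_CA A B"
  obtains M F m G h where "automaton M F m" "computes F G m h" "A = B \<circ> h"
    "(\<forall>i<k. aperiodic_aut (QA i) (fA i)) \<longrightarrow> aperiodic_aut M F"
proof -
  obtain QB fB qB FB where autB:
    "\<And>i. i < k \<Longrightarrow> automaton (QB i) (fB i) (qB i) \<and> {\<xi>. B \<xi> = i} = {\<xi>. inf_states (fB i) (qB i) \<xi> \<in> FB i}"
    using B_reg unfolding regular_lang_def by metis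
  obtain P p0 a where P: "finite P" "p0 \<in> P" "\<forall>p\<in>P. \<forall>x. product_step k fA p x \<in> P"
    "\<forall>p\<in>P. \<forall>i<k. p i \<in> QA i" "\<forall>p\<in>P. \<forall>i\<ge>k. p i = 0"
    "\<forall>\<xi>. A \<xi> = a (limit (trail (product_step k fA) p0 \<xi>))"
    by (rule partition_automaton[OF A autA])
  obtain R q0 b where R: "finite R" "q0 \<in> R" "\<forall>p\<in>R. \<forall>x. product_step k fB p x \<in> R"
    "\<forall>\<xi>. B \<xi> = b (limit (trail (product_step k fB) q0 \<xi>))"
    by (rule partition_automaton[OF B autB])
  let ?f = "product_step k fA" and ?g = "product_step k fB"
  obtain h0 where h0: "cantor_continuous h0" "A = B \<circ> h0" using le unfolding le_CA_def by blast
  interpret aut_pair ?f ?g a b .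
  have "range (trail ?g q0 \<xi>) \<subseteq> R" for \<xi>
  proof -
    have "trail ?g q0 \<xi> n \<in> R" for n by (induction n) (auto simp: R trail_Suc)
    then show ?thesis by auto
  qed
  moreover have "a (limit (trail ?f p0 \<xi>)) = b (limit (trail ?g q0 (h0 \<xi>)))" for \<xi>
    using spec[OF P(6), of \<xi>] spec[OF R(4), of "h0 \<xi>"] h0(2) by simp
  ultimately have "reduces P R p0 q0"
    using h0(1) unfolding reduces_def reduction_def by blast
  then interpret reducible_pair ?f ?g a b P R p0 q0
    using P R by unfold_locales auto
  obtain M F m G h where M: "automaton M F m" "computes F G m h"
    "\<forall>\<xi>. a (limit (trail ?f p0 \<xi>)) = b (limit (trail ?g q0 (h \<xi>)))"
    "(\<forall>p\<in>P. \<forall>u n. u \<noteq> [] \<and> n > 0 \<and> foldl ?f p (concat (replicate n u)) = p \<longrightarrow> foldl ?f p u = p)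
      \<longrightarrow> aperiodic_aut M F"
    by (rule ex_transducer)
  have "A = B \<circ> h" using M(3) P(6) R(4) by auto
  moreover have "aperiodic_aut M F" if ap: "\<forall>i<k. aperiodic_aut (QA i) (fA i)"
  proof (rule M(4)[rule_format], elim conjE)
    fix p u n assume p: "p \<in> P" and u: "u \<noteq> []" "n > (0::nat)" "foldl ?f p (concat (replicate n u)) = p"
    \<comment> \<open>Along the whole run the coordinates from \<open>k\<close> on are 0, so only
      those below \<open>k\<close> need an argument.\<close>
    have "foldl ?f p w \<in> P" for w using p by (induction w arbitrary: p) (auto simp: P(3))
    then have out: "foldl ?f p u i = p i" if "i \<ge> k" for i using P(5) p that by metis
    have "foldl ?f p u i = p i" if i: "i < k" for i
    proof -
      have "foldl (fA i) (p i) (concat (replicate n u)) = p i"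
        using u(3) foldl_product_step[OF i] by metis
      then have "foldl (fA i) (p i) u = p i"
        using ap i P(4) p i u unfolding aperiodic_aut_def ftrans_def by blast
      then show ?thesis using foldl_product_step[OF i] by metis
    qed
    then show "foldl ?f p u = p" using out by (metis ext not_le)
  qed
  ultimately show thesis using that M(1,2) by blast
qed

theorem theorem4p13:
  fixes k :: nat
  assumes "card (UNIV :: 'a::finite set) \<ge> 2" and "k \<ge> 2"
  shows "(\<forall>A\<in>RR k. \<forall>B\<in>RR k. le_CA A B \<longleftrightarrow> le_DA (A :: 'a oword \<Rightarrow> nat) B)
       \<and> (\<forall>A\<in>AA k. \<forall>B\<in>AA k. le_CA A B \<longleftrightarrow> le_AA (A :: 'a oword \<Rightarrow> nat) B)"
proof (intro conjI ballI iffI)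
  fix A B :: "'a oword \<Rightarrow> nat"
  \<comment> \<open>Functions computed by transducers are continuous.\<close>
  show "le_CA A B" if "le_DA A B"
    using that computes_continuous unfolding le_DA_def DA_function_def le_CA_def by blast
  show "le_CA A B" if "le_AA A B"
    using that computes_continuous unfolding le_AA_def AA_function_def le_CA_def by blast
next
  fix A B :: "'a oword \<Rightarrow> nat"
  assume A: "A \<in> RR k" and B: "B \<in> RR k" and le: "le_CA A B"
  have "\<forall>i. \<exists>Q f q F. i < k \<longrightarrow> automaton Q f q \<and> {\<xi>. A \<xi> = i} = {\<xi>. inf_states f q \<xi> \<in> F}"
    using A unfolding RR_def regular_lang_def by blast
  then obtain Q f q F where Q: "\<And>i. i < k \<Longrightarrow> automaton (Q i) (f i) (q i) \<and>
      {\<xi>. A \<xi> = i} = {\<xi>. inf_states (f i) (q i) \<xi> \<in> F i}"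
    by metis
  have "kpartition k A" "kpartition k B" "\<And>i. i < k \<Longrightarrow> regular_lang {\<xi>. B \<xi> = i}"
    using A B unfolding RR_def by auto
  from ex_computed_reduction[OF this(1,2) Q this(3) le]
  obtain M F m G h where "automaton M F m" "computes F G m h" "A = B \<circ> h" .
  then show "le_DA A B" unfolding le_DA_def DA_function_def by blast
next
  fix A B :: "'a oword \<Rightarrow> nat"
  assume A: "A \<in> AA k" and B: "B \<in> AA k" and le: "le_CA A B"
  have "\<forall>i. \<exists>Q f q F. i < k \<longrightarrow> automaton Q f q \<and> aperiodic_aut Q f \<and>
      {\<xi>. A \<xi> = i} = {\<xi>. inf_states f q \<xi> \<in> F}"
    using A unfolding AA_def aperiodic_lang_def by blast
  then obtain Q f q F where Q: "\<And>i. i < k \<Longrightarrow> automaton (Q i) (f i) (q i) \<and> aperiodic_aut (Q i) (f i) \<and>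
      {\<xi>. A \<xi> = i} = {\<xi>. inf_states (f i) (q i) \<xi> \<in> F i}"
    by metis
  have AB: "kpartition k A" "kpartition k B" using A B unfolding AA_def by auto
  have QA: "automaton (Q i) (f i) (q i) \<and> {\<xi>. A \<xi> = i} = {\<xi>. inf_states (f i) (q i) \<xi> \<in> F i}"
    if "i < k" for i
    using Q[OF that] by blast
  \<comment> \<open>Aperiodic languages are regular; the aperiodicity of the transducer comes from
    the automata for \<open>A\<close>.\<close>
  have "regular_lang {\<xi>. B \<xi> = i}" if "i < k" for i
    using B that unfolding AA_def aperiodic_lang_def regular_lang_def by blast
  from ex_computed_reduction[OF AB QA this le]
  obtain M F m G h where M: "automaton M F m" "computes F G m h" "A = B \<circ> h"
    "(\<forall>i<k. aperiodic_aut (Q i) (f i)) \<longrightarrow> aperiodic_aut M F" .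
  then have "aperiodic_aut M F" using Q by blast
  then show "le_AA A B" using M(1-3) unfolding le_AA_def AA_function_def by blast
qed

end
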